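(* Let $b\ge 3$ and $m\ge 2$ be integers. (i) If $\omega \in (D_b^m)^{\mathbb{N}_0}$ is a progressively overlapping sequence, then the set $K^\omega$ is $\frac{\log \lambda}{\log b}$-Ahlfors regular, where $\lambda\in(b-1, b)$ is the Pisot number satisfying the equation $x^m -(b-1)(x^{m-1}+x^{m-2} + \cdots +x+1)=0$. (ii) If $\omega \in (D_b^m)^{\mathbb{N}_0}$ is a totally distinct sequence, then the set $K^\omega$ is $\frac{\log \eta}{\log b}$-Ahlfors regular, where $\eta\in(b-1, b)$ is the Pisot number satisfying the equation $x^m -bx^{m-1} +1=0$.
   Context: $\mathbb{N}=\{1,2,\ldots\}$, $\mathbb{N}_0=\mathbb{N}\cup\{0\}$, $D_b=\{0,1,\ldots,b-1\}$; $D_b^n$ is the set of words of length $n$ over $D_b$. $(D_b^m)^{\mathbb{N}_0}$ is the set of infinite sequences $\omega=\omega^0\omega^1\ldots$ with each $\omega^k=\omega^k_1\omega^k_2\ldots\omega^k_m\in D_b^m$ (superscripts are indices). For such $\omega$, $K^\omega=\{\sum_{i=1}^\infty d_ib^{-i}: d_i\in D_b\ \forall i\in\mathbb N,\ d_{k+1}d_{k+2}\ldots d_{k+m}\ne\omega^k\ \forall k\in\mathbb{N}_0\}$. For $k\in\mathbb{N}$, $\omega$ is progressively overlapping at position-$k$ if $\omega^k_1\ldots\omega^k_{m-j}=\omega^{k-j}_{j+1}\ldots\omega^{k-j}_m$ for all $1\le j\le\min\{k,m-1\}$, and totally distinct at position-$k$ if $\omega^k_1\ldots\omega^k_{m-j}\ne\omega^{k-j}_{j+1}\ldots\omega^{k-j}_m$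 for all $1\le j\le\min\{k,m-1\}$. The sequence $\omega$ is progressively overlapping (resp. totally distinct) if it is so at position-$k$ for all $k\in\mathbb{N}$. A compact set $F\subset\mathbb{R}^n$ is $s$-Ahlfors regular if there is a constant $c\ge1$ such that $c^{-1}r^s\le\mathcal{H}^s(F\cap B(x,r))\le cr^s$ for all $0<r<1$ and all $x\in F$, where $\mathcal{H}^s$ is the $s$-dimensional Hausdorff measure and $B(x,r)$ the closed ball. A Pisot number is an algebraic integer greater than $1$ whose algebraic conjugates (other than itself) have modulus strictly less than $1$. *)

theory Defs
  imports "HOL-Analysis.Analysis" "HOL-Computational_Algebra.Computational_Algebra"
begin

section \<open>Forbidden words\<close>

definition words :: "nat \<Rightarrow> nat \<Rightarrow> nat list set" where
  "words b n = {w. set w \<subseteq> {..<b} \<and> length w = n}"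

text \<open>
  The digits \<open>d\<close> are indexed from 1; the value \<open>d 0\<close> plays no role.
\<close>

definition K_set :: "nat \<Rightarrow> nat \<Rightarrow> (nat \<Rightarrow> nat list) \<Rightarrow> real set" where
  "K_set b m \<omega> =
     {(\<Sum>i. real (d (Suc i)) / real b ^ Suc i) | d.
        (\<forall>i\<ge>1. d i < b) \<and> (\<forall>k. map d [k + 1..<k + m + 1] \<noteq> \<omega> k)}"

text \<open>
  If \<open>w\<close> has length \<open>m\<close>, then \<open>take (m - j) w\<close> is the prefix \<open>w\<^sub>1 \<dots> w\<^bsub>m - j\<^esub>\<close>
  and \<open>drop j w\<close> is the suffix \<open>w\<^bsub>j + 1\<^esub> \<dots> w\<^sub>m\<close>.
\<close>

definition progressively_overlapping_at :: "nat \<Rightarrow> (nat \<Rightarrow> nat list) \<Rightarrow> nat \<Rightarrow> bool" where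
  "progressively_overlapping_at m \<omega> k \<longleftrightarrow>
     (\<forall>j. 1 \<le> j \<and> j \<le> min k (m - 1) \<longrightarrow> take (m - j) (\<omega> k) = drop j (\<omega> (k - j)))"

definition totally_distinct_at :: "nat \<Rightarrow> (nat \<Rightarrow> nat list) \<Rightarrow> nat \<Rightarrow> bool" where
  "totally_distinct_at m \<omega> k \<longleftrightarrow>
     (\<forall>j. 1 \<le> j \<and> j \<le> min k (m - 1) \<longrightarrow> take (m - j) (\<omega> k) \<noteq> drop j (\<omega> (k - j)))"

definition progressively_overlapping :: "nat \<Rightarrow> (nat \<Rightarrow> nat list) \<Rightarrow> bool" where
  "progressively_overlapping m \<omega> \<longleftrightarrow> (\<forall>k\<ge>1. progressively_overlapping_at m \<omega> k)"

definition totally_distinct :: "nat \<Rightarrow> (nat \<Rightarrow> nat list) \<Rightarrow> bool" where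
  "totally_distinct m \<omega> \<longleftrightarrow> (\<forall>k\<ge>1. totally_distinct_at m \<omega> k)"


section \<open>Hausdorff measure and Ahlfors regularity\<close>

text \<open>
  The term \<open>|U|\<^sup>s\<close> of a covering set, for \<open>s \<ge> 0\<close>. The empty set contributes 0 and, for
  \<open>s = 0\<close>, every nonempty set contributes 1; the case distinction is needed because
  \<open>0 powr 0 = 0\<close>.
\<close>

definition diam_powr :: "real \<Rightarrow> 'a::metric_space set \<Rightarrow> ennreal" where
  "diam_powr s U = (if U = {} then 0 else if s = 0 then 1 else ennreal (diameter U powr s))"

text \<open>
  Covers consist of bounded sets because \<^const>\<open>diameter\<close> is unspecified on unbounded ones.
  Finite covers are included by padding with empty sets.
\<close>

definition hausdorff_premeasure ::
    "real \<Rightarrow> real \<Rightarrow> 'a::metric_space set \<Rightarrow> ennreal" where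
  "hausdorff_premeasure s \<delta> A =
     (INF U \<in> {U :: nat \<Rightarrow> 'a set. A \<subseteq> (\<Union>i. U i) \<and> (\<forall>i. bounded (U i) \<and> diameter (U i) \<le> \<delta>)}.
        \<Sum>i. diam_powr s (U i))"

definition hausdorff_measure :: "real \<Rightarrow> 'a::metric_space set \<Rightarrow> ennreal" where
  "hausdorff_measure s A = (SUP \<delta> \<in> {0<..}. hausdorff_premeasure s \<delta> A)"

definition ahlfors_regular :: "real \<Rightarrow> 'a::euclidean_space set \<Rightarrow> bool" where
  "ahlfors_regular s F \<longleftrightarrow> compact F \<and>
     (\<exists>c::real. c \<ge> 1 \<and>
        (\<forall>r x. 0 < r \<and> r < 1 \<and> x \<in> F \<longrightarrow>
           ennreal (inverse c * r powr s) \<le> hausdorff_measure s (F \<inter> cball x r) \<and>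
           hausdorff_measure s (F \<inter> cball x r) \<le> ennreal (c * r powr s)))"


section \<open>Pisot numbers\<close>

text \<open>
  The polynomial \<open>p\<close> below is the minimal polynomial of \<open>x\<close> over the rationals.
\<close>

definition algebraic_conjugate :: "complex \<Rightarrow> complex \<Rightarrow> bool" where
  "algebraic_conjugate x z \<longleftrightarrow>
     (\<exists>p :: rat poly. irreducible p \<and> lead_coeff p = 1 \<and>
        poly (map_poly of_rat p) x = 0 \<and> poly (map_poly of_rat p) z = 0)"

definition pisot :: "real \<Rightarrow> bool" where
  "pisot x \<longleftrightarrow> algebraic_int x \<and> x > 1 \<and>
     (\<forall>z. algebraic_conjugate (of_real x) z \<and> z \<noteq> of_real x \<longrightarrow> cmod z < 1)"

end

theory Submission
  imports Defs "HOL-Computational_Algebra.Field_as_Ring"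
begin

text \<open>
  Write \<open>\<beta>\<close> for \<open>lam\<close> or \<open>\<eta>\<close>. Give an admissible word \<open>u\<close> the weight
  \<open>\<phi> u = 1 - (\<Sum>r. x r)\<close>, where \<open>r\<close> runs over the lengths of the suffixes of \<open>u\<close> that are
  proper beginnings of forbidden words at their position, and \<open>x r\<close> is proportional to \<open>\<beta> ^ r\<close>.
  The defining equation of \<open>\<beta>\<close> makes the weights of the admissible children of \<open>u\<close> add up to
  \<open>\<beta> * \<phi> u\<close>, and \<open>\<phi>\<close> is bounded between positive constants. So
  \<open>\<phi> u / \<beta> ^ length u\<close> is a mass distribution on the tree of admissible words that is comparable
  to \<open>b\<close> to the power \<open>- s * length u\<close> with \<open>s = log b \<beta>\<close>, which is Ahlfors regularity.

  For the Pisot property it suffices that \<open>\<beta>\<close> is the only complex root outside the open unit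
  disc, because the minimal polynomial divides the given one.
\<close>

section \<open>Expansions in base \<open>b\<close>\<close>

text \<open>Digits are indexed from 0 here, while \<open>K_set\<close> reads them from index 1;
  \<open>K_set_eq\<close> reconciles the two conventions.\<close>

definition base_value :: "nat \<Rightarrow> (nat \<Rightarrow> nat) \<Rightarrow> real" where
  "base_value b d = (\<Sum>i. real (d i) / real b ^ Suc i)"

definition word_value :: "nat \<Rightarrow> nat list \<Rightarrow> nat" where
  "word_value b u = foldl (\<lambda>a x. b * a + x) 0 u"

lemma word_value_Nil [simp]: "word_value b [] = 0"
  and word_value_snoc [simp]: "word_value b (u @ [x]) = b * word_value b u + x"
  by (simp_all add: word_value_def)

text \<open>Division by \<open>b\<close> with remainder recovers the last digit and the value of the
  remaining word, so induction from the right applies.\<close>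

lemma word_value_inj:
  assumes "word_value b u = word_value b v" "length u = length v"
    and "set u \<subseteq> {..<b}" "set v \<subseteq> {..<b}"
  shows "u = v"
  using assms
proof (induction u arbitrary: v rule: rev_induct)
  case Nil
  then show ?case by simp
next
  case (snoc x u)
  then obtain v' y where v: "v = v' @ [y]"
    by (cases v rule: rev_cases) auto
  have eq: "b * word_value b u + x = b * word_value b v' + y" and xy: "x < b" "y < b"
    using snoc.prems v by auto
  have "word_value b u = (b * word_value b u + x) div b" "x = (b * word_value b u + x) mod b"
    "word_value b v' = (b * word_value b v' + y) div b" "y = (b * word_value b v' + y) mod b"
    using xy by auto
  then have "word_value b u = word_value b v'" "x = y"
    using eq by metis+
  then show ?case
    using snoc.IH[of v'] snoc.prems v by auto
qed

context
  fixes b :: nat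
  assumes b: "2 \<le> b"
begin

lemma digit_term_le: "real x / real b ^ Suc i \<le> (real b - 1) / real b ^ Suc i" if "x < b"
  using that b by (intro divide_right_mono) auto

lemma geometric_digits_sums: "(\<lambda>i. (real b - 1) / real b ^ Suc i) sums 1"
proof -
  have "(\<lambda>i. ((real b - 1) / real b) * (1 / real b) ^ i) sums
      (((real b - 1) / real b) * (1 / (1 - 1 / real b)))"
    using b by (intro sums_mult geometric_sums) auto
  moreover have "((real b - 1) / real b) * (1 / (1 - 1 / real b)) = 1"
    using b by (simp add: field_simps)
  ultimately show ?thesis
    by (simp add: power_one_over field_simps)
qed

lemma summable_digits:
  assumes "\<And>i. d i < b"
  shows "summable (\<lambda>i. real (d i) / real b ^ Suc i)"
  by (rule summable_comparison_test'[OF sums_summable[OF geometric_digits_sums], of 0])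
    (use digit_term_le[OF assms] in auto)

lemma base_value_bounds:
  assumes "\<And>i. d i < b"
  shows "0 \<le> base_value b d" "base_value b d \<le> 1"
proof -
  show "0 \<le> base_value b d"
    unfolding base_value_def by (intro suminf_nonneg summable_digits assms) auto
  have "base_value b d \<le> (\<Sum>i. (real b - 1) / real b ^ Suc i)"
    unfolding base_value_def
    by (intro suminf_le digit_term_le summable_digits sums_summable[OF geometric_digits_sums] assms)
  then show "base_value b d \<le> 1"
    using sums_unique[OF geometric_digits_sums] by simp
qed

text \<open>Scaling by \<open>b ^ n\<close> splits the number into the integer coded by its first
  \<open>n\<close> digits and a tail that again lies in the unit interval.\<close>

lemma base_value_shift:
  assumes "\<And>i. d i < b"
  shows "base_value b d =
    (real (word_value b (map d [0..<n])) + base_value b (\<lambda>i. d (i + n))) / real b ^ n"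
proof (induction n)
  case 0
  then show ?case by simp
next
  case (Suc n)
  let ?e = "\<lambda>i. d (i + n)"
  have "base_value b ?e = (\<Sum>i. real (?e (Suc i)) / real b ^ Suc (Suc i)) + real (?e 0) / real b ^ Suc 0"
    unfolding base_value_def
    using suminf_split_head[OF summable_digits, of ?e] assms by simp
  also have "(\<Sum>i. real (?e (Suc i)) / real b ^ Suc (Suc i))
      = base_value b (\<lambda>i. d (i + Suc n)) / real b"
    unfolding base_value_def
    using suminf_divide[OF summable_digits, of "\<lambda>i. d (i + Suc n)" "real b"] assms
    by (simp add: field_simps)
  finally have "base_value b ?e = (real (d n) + base_value b (\<lambda>i. d (i + Suc n))) / real b"
    using b by (simp add: field_simps)
  then show ?case
    using Suc b by (simp add: field_simps)
qed

text \<open>After scaling by \<open>b ^ n\<close> the value is within 1 of \<open>z * b ^ n\<close>,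
  and the prefix integer is this value minus a tail between 0 and 1. So the integer lies between
  \<open>z * b ^ n - 2\<close> and \<open>z * b ^ n + 1\<close>, which leaves four
  candidates.\<close>

lemma card_prefixes_in_ball:
  fixes D :: "(nat \<Rightarrow> nat) set"
  assumes dig: "\<And>d i. d \<in> D \<Longrightarrow> d i < b" and near: "\<And>d. d \<in> D \<Longrightarrow> base_value b d \<in> cball z \<rho>"
    and rho: "\<rho> \<le> 1 / real b ^ n"
  shows "finite ((\<lambda>d. map d [0..<n]) ` D) \<and> card ((\<lambda>d. map d [0..<n]) ` D) \<le> 4"
proof -
  let ?S = "(\<lambda>d. map d [0..<n]) ` D" and ?f = "\<lambda>u. int (word_value b u)"
  let ?t = "\<lfloor>z * real b ^ n\<rfloor>"
  have inj: "inj_on ?f ?S"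
  proof (rule inj_onI)
    fix u v assume "u \<in> ?S" "v \<in> ?S" "?f u = ?f v"
    then show "u = v" using dig by (intro word_value_inj) auto
  qed
  have sub: "?f ` ?S \<subseteq> {?t - 2..?t + 1}"
  proof clarify
    fix d assume d: "d \<in> D"
    have e: "base_value b d * real b ^ n
        = real (word_value b (map d [0..<n])) + base_value b (\<lambda>i. d (i + n))"
      using base_value_shift[of d n] dig[OF d] b by (simp add: field_simps)
    have "\<bar>z - base_value b d\<bar> \<le> 1 / real b ^ n"
      using near[OF d] rho by (simp add: dist_real_def)
    then have "\<bar>z - base_value b d\<bar> * real b ^ n \<le> 1"
      using b by (simp add: field_simps)
    then have "\<bar>z * real b ^ n - base_value b d * real b ^ n\<bar> \<le> 1"
      using b by (simp add: left_diff_distrib[symmetric] abs_mult)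
    then show "?f (map d [0..<n]) \<in> {?t - 2..?t + 1}"
      using base_value_bounds[of "\<lambda>i. d (i + n)"] dig[OF d] unfolding e
      by (auto simp: floor_le_iff le_floor_iff) linarith+
  qed
  have "finite (?f ` ?S)" using sub finite_subset by blast
  moreover have "card (?f ` ?S) \<le> 4"
    using card_mono[OF _ sub] by simp
  ultimately show ?thesis
    using inj by (simp add: card_image finite_image_iff)
qed

section \<open>Topology of the space of digit sequences\<close>

lemma continuous_on_base_value: "continuous_on {d. \<forall>i. d i < b} (base_value b)"
proof -
  let ?f = "\<lambda>n d. \<Sum>i<n. real (d i) / real b ^ Suc i"
  have "uniform_limit {d. \<forall>i. d i < b} ?f (\<lambda>d. \<Sum>i. real (d i) / real b ^ Suc i) sequentially"
    by (rule Weierstrass_m_test[OF _ sums_summable[OF geometric_digits_sums]])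
      (use digit_term_le in auto)
  moreover have "continuous_on {d. \<forall>i. d i < b} (?f n)" for n
    by (intro continuous_intros continuous_on_compose2[of UNIV "real" _ "\<lambda>d. d i" for i]
        continuous_on_product_coordinates[THEN continuous_on_subset]) auto
  ultimately show ?thesis
    unfolding base_value_def by (intro uniform_limit_theorem) auto
qed

end

text \<open>A prefix depends on finitely many coordinates in a discrete space. Applied to
  complements as well, this makes prefix conditions closed, which yields compactness of the path
  space.\<close>

lemma open_prefix: "open {d :: nat \<Rightarrow> nat. map d [0..<n] \<in> A}"
proof (subst open_subopen, intro ballI)
  fix d assume d: "d \<in> {d :: nat \<Rightarrow> nat. map d [0..<n] \<in> A}"
  let ?U = "PiE UNIV (\<lambda>i. if i < n then {d i} else UNIV)"
  have "open ?U"
    by (rule open_PiE) (auto simp: open_discrete)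
  moreover have "?U \<subseteq> {d. map d [0..<n] \<in> A}"
  proof
    fix e assume e: "e \<in> ?U"
    have "e i = d i" if "i < n" for i
      using PiE_mem[OF e, of i] that by simp
    then have "map e [0..<n] = map d [0..<n]" by auto
    then show "e \<in> {d. map d [0..<n] \<in> A}" using d by (simp del: map_eq_conv)
  qed
  moreover have "d \<in> ?U" by auto
  ultimately show "\<exists>T. open T \<and> d \<in> T \<and> T \<subseteq> {d. map d [0..<n] \<in> A}" by blast
qed

lemma closed_prefix: "closed {d :: nat \<Rightarrow> nat. map d [0..<n] \<in> A}"
  using open_prefix[of n "- A"] by (simp add: closed_def Compl_eq)

lemma compact_digits: "compact {d :: nat \<Rightarrow> nat. \<forall>i. d i < b}"
proof -
  have "compactin (product_topology (\<lambda>i. euclidean) UNIV) (PiE UNIV (\<lambda>i :: nat. {..<b}))"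
    by (simp add: compactin_PiE finite_imp_compact)
  then show ?thesis
    by (simp add: euclidean_product_topology PiE_UNIV_domain Pi_def)
qed

section \<open>Tools for sums, scales and finite covers\<close>

lemma sum_UN_le_sum:
  fixes f :: "'a \<Rightarrow> real"
  assumes "finite I" "\<And>i. i \<in> I \<Longrightarrow> finite (A i)" "\<And>i x. i \<in> I \<Longrightarrow> x \<in> A i \<Longrightarrow> 0 \<le> f x"
  shows "sum f (\<Union>i\<in>I. A i) \<le> (\<Sum>i\<in>I. sum f (A i))"
  using assms
proof (induction I rule: finite_induct)
  case (insert i I)
  have "sum f (A i \<union> (\<Union>j\<in>I. A j)) \<le> sum f (A i) + sum f (\<Union>j\<in>I. A j)"
    using insert by (subst sum_Un) (auto intro!: sum_nonneg)
  also have "\<dots> \<le> sum f (A i) + (\<Sum>j\<in>I. sum f (A j))"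
    using insert by auto
  finally show ?case using insert by simp
qed simp

lemma exists_scale:
  fixes r :: real
  assumes "2 \<le> b" "0 < r" "r \<le> 1"
  shows "\<exists>n. 1 / real b ^ Suc n < r \<and> r \<le> 1 / real b ^ n"
proof -
  have "\<exists>n. (1 / real b) ^ n < r"
    using assms by (intro real_arch_pow_inv) auto
  then obtain n where n: "(1 / real b) ^ n < r" "\<And>k. k < n \<Longrightarrow> \<not> (1 / real b) ^ k < r"
    using exists_least_iff[of "\<lambda>n. (1 / real b) ^ n < r"] by auto
  then obtain k where "n = Suc k"
    \<comment> \<open>The least exponent is not 0 because \<open>r \<le> 1\<close>; its predecessor
      is the required scale.\<close>
    using assms by (cases n) auto
  with n(1) n(2)[of k] have "(1 / real b) ^ Suc k < r" "r \<le> (1 / real b) ^ k"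
    by simp_all
  then show ?thesis by (auto simp: power_one_over)
qed

text \<open>Covers in the definition are indexed by all natural numbers, so \<open>R\<close> is
  enumerated and padded with empty sets, which contribute 0 and have diameter
  \<open>0 \<le> \<delta>\<close>.\<close>

lemma hausdorff_premeasure_le_finite_cover:
  assumes "finite R" "A \<subseteq> (\<Union>v\<in>R. C v)" "\<And>v. v \<in> R \<Longrightarrow> bounded (C v) \<and> diameter (C v) \<le> \<delta>"
    and "0 \<le> \<delta>"
  shows "hausdorff_premeasure s \<delta> A \<le> (\<Sum>v\<in>R. diam_powr s (C v))"
proof -
  obtain h where h: "bij_betw h {0..<card R} R"
    using ex_bij_betw_nat_finite[OF \<open>finite R\<close>] by auto
  define U where "U i = (if i < card R then C (h i) else {})" for i
  have hR: "h i \<in> R" if "i < card R" for i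
    using h that by (auto simp: bij_betw_def)
  have "A \<subseteq> (\<Union>i. U i)"
  proof
    fix a assume "a \<in> A"
    then obtain v where "v \<in> R" "a \<in> C v" using assms(2) by auto
    then obtain i where "i < card R" "h i = v"
      using bij_betw_imp_surj_on[OF h] by (metis atLeastLessThan_iff imageE)
    then show "a \<in> (\<Union>i. U i)" using \<open>a \<in> C v\<close> by (auto simp: U_def intro!: exI[of _ i])
  qed
  moreover have "\<forall>i. bounded (U i) \<and> diameter (U i) \<le> \<delta>"
    using assms(3,4) hR by (auto simp: U_def)
  ultimately have "hausdorff_premeasure s \<delta> A \<le> (\<Sum>i. diam_powr s (U i))"
    unfolding hausdorff_premeasure_def by (intro INF_lower) auto
  also have "\<dots> = (\<Sum>i<card R. diam_powr s (U i))"
    by (intro suminf_finite) (auto simp: U_def diam_powr_def)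
  also have "\<dots> = (\<Sum>i\<in>{0..<card R}. diam_powr s (C (h i)))"
    by (intro sum.cong) (auto simp: U_def)
  also have "\<dots> = (\<Sum>v\<in>R. diam_powr s (C v))"
    by (rule sum.reindex_bij_betw[OF h])
  finally show ?thesis .
qed

section \<open>Weighted trees of words\<close>

text \<open>The abstract setting shared by both parts of the theorem: only the bounds on the weights
  and the growth rule \<open>weight_sum\<close> enter, not the forbidden words.\<close>

locale weighted_word_tree =
  fixes b :: nat and T :: "nat list set" and \<phi> :: "nat list \<Rightarrow> real" and \<beta> c :: real
  assumes base: "2 \<le> b" and Nil_in: "[] \<in> T"
    and snoc_in: "u @ [x] \<in> T \<Longrightarrow> u \<in> T \<and> x < b"
    and beta: "1 < \<beta>" and c: "0 < c"
    and weight_ge: "u \<in> T \<Longrightarrow> c \<le> \<phi> u" and weight_le: "u \<in> T \<Longrightarrow> \<phi> u \<le> 1"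
    and weight_sum: "u \<in> T \<Longrightarrow> (\<Sum>x | x < b \<and> u @ [x] \<in> T. \<phi> (u @ [x])) = \<beta> * \<phi> u"
begin

section \<open>Paths, descendants and conservation of mass\<close>

definition paths :: "(nat \<Rightarrow> nat) set" where
  "paths = {d. \<forall>n. map d [0..<n] \<in> T}"

definition extensions :: "nat list \<Rightarrow> nat \<Rightarrow> nat list set" where
  "extensions u k = {v \<in> T. length v = length u + k \<and> take (length u) v = u}"

text \<open>Since expansions need not be unique, cylinders of different words of one length may
  share points; the estimates therefore count words, not points.\<close>

definition cylinder :: "nat list \<Rightarrow> real set" where
  "cylinder u = base_value b ` {d \<in> paths. map d [0..<length u] = u}"

abbreviation s :: real where "s \<equiv> ln \<beta> / ln (real b)"

lemma s_pos: "0 < s"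
  using base beta by simp

text \<open>The exponent \<open>s\<close> is the one with \<open>b powr s = \<beta>\<close>, so the
  scale \<open>1 / b ^ n\<close> turns into the mass scale \<open>1 / \<beta> ^ n\<close>.\<close>

lemma base_powr_s: "(1 / real b ^ n) powr s = 1 / \<beta> ^ n"
proof -
  have "real b powr s = \<beta>"
    using base beta by (simp add: powr_def)
  then have "(real b ^ n) powr s = \<beta> ^ n"
    using base by (induction n) (simp_all add: powr_mult)
  then show ?thesis
    using base by (simp add: powr_divide)
qed

lemma weight_pos: "u \<in> T \<Longrightarrow> 0 < \<phi> u"
  using weight_ge c by force

lemma path_digit: "d \<in> paths \<Longrightarrow> d i < b"
  using snoc_in[of "map d [0..<i]" "d i"] by (auto simp: paths_def dest!: spec[of _ "Suc i"])

lemma prefix_in: "u @ v \<in> T \<Longrightarrow> u \<in> T"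
proof (induction v rule: rev_induct)
  case (snoc x v)
  then show ?case using snoc_in[of "u @ v" x] by simp
qed simp

lemma take_in: "v \<in> T \<Longrightarrow> take n v \<in> T"
  using prefix_in[of "take n v" "drop n v"] by simp

lemma extensions_0 [simp]: "u \<in> T \<Longrightarrow> extensions u 0 = {u}"
  by (auto simp: extensions_def)

lemma extensions_Suc:
  "extensions u (Suc k) = (\<Union>v\<in>extensions u k. (\<lambda>x. v @ [x]) ` {x. x < b \<and> v @ [x] \<in> T})"
proof (rule set_eqI, rule iffI)
  fix v assume v: "v \<in> extensions u (Suc k)"
  then obtain v' x where "v = v' @ [x]"
    by (cases v rule: rev_cases) (auto simp: extensions_def)
  with v show "v \<in> (\<Union>v\<in>extensions u k. (\<lambda>x. v @ [x]) ` {x. x < b \<and> v @ [x] \<in> T})"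
    using snoc_in[of v' x] by (auto simp: extensions_def intro!: bexI[of _ v'])
qed (auto simp: extensions_def)

lemma finite_extensions: "u \<in> T \<Longrightarrow> finite (extensions u k)"
  by (induction k) (auto simp: extensions_Suc)

text \<open>This is \<open>weight_sum\<close> iterated over \<open>k\<close> levels: the mass
  \<open>\<phi> u / \<beta> ^ length u\<close> is preserved when a word is replaced by its
  descendants.\<close>

lemma sum_extensions:
  assumes "u \<in> T"
  shows "(\<Sum>v\<in>extensions u k. \<phi> v) = \<beta> ^ k * \<phi> u"
proof (induction k)
  case 0
  then show ?case using assms by simp
next
  case (Suc k)
  have "(\<Sum>v\<in>extensions u (Suc k). \<phi> v)
      = (\<Sum>v\<in>extensions u k. \<Sum>w\<in>(\<lambda>x. v @ [x]) ` {x. x < b \<and> v @ [x] \<in> T}. \<phi> w)"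
    unfolding extensions_Suc
    by (rule sum.UNION_disjoint) (use finite_extensions[OF assms] in auto)
  also have "\<dots> = (\<Sum>v\<in>extensions u k. \<Sum>x | x < b \<and> v @ [x] \<in> T. \<phi> (v @ [x]))"
    by (intro sum.cong refl sum.reindex_cong[where l = "\<lambda>x. _ @ [x]"]) (auto simp: inj_on_def)
  also have "\<dots> = (\<Sum>v\<in>extensions u k. \<beta> * \<phi> v)"
    by (intro sum.cong refl weight_sum) (auto simp: extensions_def)
  finally show ?case
    using Suc by (simp add: sum_distrib_left[symmetric])
qed

text \<open>Each descendant weighs at least \<open>c\<close>, while together they weigh at most
  \<open>\<beta> ^ k\<close>.\<close>

lemma card_extensions: "u \<in> T \<Longrightarrow> c * real (card (extensions u k)) \<le> \<beta> ^ k"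
proof -
  assume u: "u \<in> T"
  have "c * real (card (extensions u k)) = (\<Sum>v\<in>extensions u k. c)" by simp
  also have "\<dots> \<le> (\<Sum>v\<in>extensions u k. \<phi> v)"
    by (intro sum_mono weight_ge) (auto simp: extensions_def)
  also have "\<dots> \<le> \<beta> ^ k * 1"
    unfolding sum_extensions[OF u] using weight_le[OF u] beta by (intro mult_left_mono) auto
  finally show ?thesis by simp
qed

text \<open>Without children the sum in \<open>weight_sum\<close> would be empty, but it equals the
  positive number \<open>\<beta> * \<phi> u\<close>.\<close>

lemma exists_child:
  assumes "u \<in> T"
  shows "\<exists>x. u @ [x] \<in> T"
proof (rule ccontr)
  assume "\<not> ?thesis"
  then have "\<beta> * \<phi> u = 0"
    using weight_sum[OF assms] by simp
  then show False using weight_pos[OF assms] beta by simp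
qed

lemma exists_path:
  assumes "u \<in> T"
  shows "\<exists>d\<in>paths. map d [0..<length u] = u"
proof -
  \<comment> \<open>As there are no dead ends, dependent choice yields a chain of words growing by
    one letter at a time; the path is its limit.\<close>
  have "\<exists>w. \<forall>n. (w n \<in> T \<and> length (w n) = length u + n \<and> take (length u) (w n) = u)
      \<and> (\<exists>x. w (Suc n) = w n @ [x])"
  proof (rule dependent_nat_choice)
    show "\<exists>w. w \<in> T \<and> length w = length u + 0 \<and> take (length u) w = u"
      using assms by auto
  next
    fix w n assume w: "w \<in> T \<and> length w = length u + n \<and> take (length u) w = u"
    then obtain x where "w @ [x] \<in> T" using exists_child by blast
    with w show "\<exists>w'. (w' \<in> T \<and> length w' = length u + Suc n \<and> take (length u) w' = u)
        \<and> (\<exists>x. w' = w @ [x])"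
      by (intro exI[of _ "w @ [x]"]) auto
  qed
  then obtain w where w: "\<And>n. w n \<in> T" "\<And>n. length (w n) = length u + n"
    "\<And>n. take (length u) (w n) = u" "\<And>n. \<exists>x. w (Suc n) = w n @ [x]"
    by auto
  have coh: "w (n + k) ! i = w n ! i" if "i < length u + n" for i n k
  proof (induction k)
    case (Suc k)
    obtain x where "w (Suc (n + k)) = w (n + k) @ [x]" using w(4) by blast
    then show ?case using Suc that by (simp add: nth_append w(2))
  qed simp
  \<comment> \<open>The word \<open>w (Suc i)\<close> is long enough to have a letter at index
    \<open>i\<close>, even if \<open>u\<close> is empty.\<close>
  define d where "d i = w (Suc i) ! i" for i
  have d: "d i = w n ! i" if "i < length u + n" for i n
  proof (cases "n \<le> Suc i")
    case True
    then obtain k where "Suc i = n + k" using le_Suc_ex by blast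
    then show ?thesis using coh[of i n k] that by (simp add: d_def)
  next
    case False
    then obtain k where "n = Suc i + k" using le_Suc_ex by (metis nat_le_linear)
    then show ?thesis using coh[of i "Suc i" k] by (simp add: d_def)
  qed
  have pre: "map d [0..<n] = take n (w n)" for n
    by (rule nth_equalityI) (use d[of _ n] w(2) in auto)
  have "d \<in> paths"
    unfolding paths_def using pre take_in w(1) by auto
  moreover have "map d [0..<length u] = u"
    by (rule nth_equalityI) (use d[of _ 0] w(2,3)[of 0] in auto)
  ultimately show ?thesis by blast
qed

section \<open>Cylinders and the upper bound for the Hausdorff measure\<close>

lemma compact_cylinder: "compact (cylinder u)"
proof -
  \<comment> \<open>Lying on a path and starting with \<open>u\<close> are written as closed prefix
    conditions inside the compact space of digit sequences.\<close>
  have "{d \<in> paths. map d [0..<length u] = u}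
      = {d. \<forall>i. d i < b} \<inter> ((\<Inter>n. {d. map d [0..<n] \<in> T}) \<inter> {d. map d [0..<length u] \<in> {u}})"
    using path_digit by (auto simp: paths_def)
  moreover have "compact \<dots>"
    by (intro compact_Int_closed compact_digits closed_Int closed_INT ballI closed_prefix)
  ultimately have "compact {d \<in> paths. map d [0..<length u] = u}" by simp
  moreover have "continuous_on {d \<in> paths. map d [0..<length u] = u} (base_value b)"
    using path_digit by (intro continuous_on_subset[OF continuous_on_base_value[OF base]]) auto
  ultimately show ?thesis
    unfolding cylinder_def by (rule compact_continuous_image[rotated])
qed

lemma cylinder_Nil: "cylinder [] = base_value b ` paths"
  by (simp add: cylinder_def)

lemma cylinder_dist:
  assumes "x \<in> cylinder u" "y \<in> cylinder u"
  shows "\<bar>x - y\<bar> \<le> 1 / real b ^ length u"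
proof -
  obtain d e where d: "d \<in> paths" "map d [0..<length u] = u" "x = base_value b d"
    and e: "e \<in> paths" "map e [0..<length u] = u" "y = base_value b e"
    using assms by (auto simp: cylinder_def)
  let ?d = "base_value b (\<lambda>i. d (i + length u))" and ?e = "base_value b (\<lambda>i. e (i + length u))"
  have "x - y = (?d - ?e) / real b ^ length u"
    using base_value_shift[OF base, of d "length u"] base_value_shift[OF base, of e "length u"]
      path_digit[OF d(1)] path_digit[OF e(1)]
    by (simp add: d e diff_divide_distrib[symmetric])
  moreover have "\<bar>?d - ?e\<bar> \<le> 1"
    using base_value_bounds[OF base, of "\<lambda>i. d (i + length u)"] path_digit[OF d(1)]
      base_value_bounds[OF base, of "\<lambda>i. e (i + length u)"] path_digit[OF e(1)] by fastforce
  ultimately show ?thesis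
    by (simp add: abs_divide divide_right_mono)
qed

lemma cylinder_extensions: "cylinder u \<subseteq> (\<Union>v\<in>extensions u k. cylinder v)"
proof
  fix x assume "x \<in> cylinder u"
  then obtain d where d: "d \<in> paths" "map d [0..<length u] = u" "x = base_value b d"
    by (auto simp: cylinder_def)
  let ?v = "map d [0..<length u + k]"
  have "take (length u) ?v = u"
    using d(2) by (simp add: take_map)
  then have "?v \<in> extensions u k"
    using d(1) by (auto simp: extensions_def paths_def)
  moreover have "x \<in> cylinder ?v"
    using d by (auto simp: cylinder_def)
  ultimately show "x \<in> (\<Union>v\<in>extensions u k. cylinder v)" by blast
qed

text \<open>Descending \<open>k\<close> more levels gives a cover of mesh at most
  \<open>\<delta>\<close> by at most \<open>4 * \<beta> ^ k / c\<close> cylinders, each contributing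
  at most \<open>1 / \<beta> ^ (n + k)\<close>. The factor \<open>\<beta> ^ k\<close> cancels, so
  the bound does not depend on \<open>\<delta>\<close>.\<close>

lemma hausdorff_measure_cylinders_le:
  assumes S: "finite S" "card S \<le> 4" "\<And>u. u \<in> S \<Longrightarrow> u \<in> T \<and> length u = n"
    and A: "A \<subseteq> (\<Union>u\<in>S. cylinder u)"
  shows "hausdorff_measure s A \<le> ennreal (4 / c / \<beta> ^ n)"
  unfolding hausdorff_measure_def
proof (rule SUP_least)
  fix \<delta> :: real assume "\<delta> \<in> {0<..}"
  then have \<delta>: "0 < \<delta>" by simp
  obtain k where k: "(1 / real b) ^ k < \<delta>"
    using real_arch_pow_inv[OF \<delta>, of "1 / real b"] base by auto
  have "1 / real b ^ (n + k) \<le> 1 / real b ^ k"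
    using base by (intro divide_left_mono power_increasing) auto
  with k have kn: "1 / real b ^ (n + k) \<le> \<delta>"
    by (simp add: power_one_over)
  define R where "R = (\<Union>u\<in>S. extensions u k)"
  have len: "length v = n + k" if "v \<in> R" for v
    using that S(3) by (auto simp: R_def extensions_def)
  have finR: "finite R"
    unfolding R_def using S finite_extensions by blast
  have "real (card R) \<le> (\<Sum>u\<in>S. real (card (extensions u k)))"
    using card_UN_le[OF S(1), of "\<lambda>u. extensions u k"] unfolding R_def
    by (metis of_nat_le_iff of_nat_sum)
  also have "\<dots> \<le> (\<Sum>u\<in>S. \<beta> ^ k / c)"
    using card_extensions S(3) c by (intro sum_mono) (auto simp: field_simps)
  also have "\<dots> \<le> 4 * (\<beta> ^ k / c)"
    using S(2) beta c by (auto intro!: mult_right_mono simp del: times_divide_eq_right)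
  finally have cardR: "real (card R) \<le> 4 * (\<beta> ^ k / c)" .
  have diam: "bounded (cylinder v) \<and> diameter (cylinder v) \<le> 1 / real b ^ (n + k)" if "v \<in> R" for v
    using compact_imp_bounded[OF compact_cylinder] cylinder_dist[of _ v] len[OF that] base
    by (auto intro!: diameter_le)
  have dp: "diam_powr s (cylinder v) \<le> ennreal (1 / \<beta> ^ (n + k))" if "v \<in> R" for v
  proof -
    have "0 \<le> diameter (cylinder v)"
      using diam[OF that] by (intro diameter_ge_0) auto
    then have "diameter (cylinder v) powr s \<le> (1 / real b ^ (n + k)) powr s"
      using diam[OF that] s_pos by (intro powr_mono2) auto
    then show ?thesis
      using s_pos beta base unfolding base_powr_s by (auto simp: diam_powr_def intro!: ennreal_leI)
  qed
  have "hausdorff_premeasure s \<delta> A \<le> (\<Sum>v\<in>R. diam_powr s (cylinder v))"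
  proof (rule hausdorff_premeasure_le_finite_cover[OF finR])
    show "A \<subseteq> (\<Union>v\<in>R. cylinder v)"
      using A cylinder_extensions[of _ k] unfolding R_def by blast
    show "bounded (cylinder v) \<and> diameter (cylinder v) \<le> \<delta>" if "v \<in> R" for v
      using diam[OF that] kn by auto
  qed (use \<delta> in auto)
  also have "\<dots> \<le> (\<Sum>v\<in>R. ennreal (1 / \<beta> ^ (n + k)))"
    using dp by (intro sum_mono)
  also have "\<dots> = ennreal (real (card R) * (1 / \<beta> ^ (n + k)))"
    using beta by (subst sum_ennreal) auto
  also have "\<dots> \<le> ennreal (4 / c / \<beta> ^ n)"
  proof (rule ennreal_leI)
    have "real (card R) * (1 / \<beta> ^ (n + k)) \<le> 4 * (\<beta> ^ k / c) * (1 / \<beta> ^ (n + k))"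
      using beta by (intro mult_right_mono cardR) auto
    also have "\<dots> = 4 / c / \<beta> ^ n"
      using beta c by (simp add: power_add field_simps)
    finally show "real (card R) * (1 / \<beta> ^ (n + k)) \<le> 4 / c / \<beta> ^ n" .
  qed
  finally show "hausdorff_premeasure s \<delta> A \<le> ennreal (4 / c / \<beta> ^ n)" .
qed

section \<open>Mass distribution and the lower bound for the Hausdorff measure\<close>

abbreviation prefixes_near :: "nat \<Rightarrow> real \<Rightarrow> real \<Rightarrow> nat list set" where
  "prefixes_near n z \<rho> \<equiv> (\<lambda>d. map d [0..<n]) ` {d \<in> paths. base_value b d \<in> cball z \<rho>}"

lemma prefixes_near_in: "v \<in> prefixes_near n z \<rho> \<Longrightarrow> v \<in> T \<and> length v = n"
  by (auto simp: paths_def)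

lemma card_prefixes_near:
  assumes "\<rho> \<le> 1 / real b ^ n"
  shows "finite (prefixes_near n z \<rho>)" "card (prefixes_near n z \<rho>) \<le> 4"
  using card_prefixes_in_ball[OF base _ _ assms, of "{d \<in> paths. base_value b d \<in> cball z \<rho>}" z]
    path_digit by auto

text \<open>The factor \<open>\<beta>\<close> is the price of passing from level
  \<open>Suc n\<close> to level \<open>n\<close>.\<close>

lemma scale_powr_le:
  assumes "1 / real b ^ Suc n < r"
  shows "1 / \<beta> ^ n \<le> \<beta> * r powr s"
proof -
  have "(1 / real b ^ Suc n) powr s \<le> r powr s"
    using assms s_pos base by (intro powr_mono2) auto
  then show ?thesis
    unfolding base_powr_s using beta by (simp add: field_simps)
qed

lemma exists_scale_near:
  assumes "0 < \<rho>"
  shows "\<exists>n. 1 / \<beta> ^ n \<le> \<beta> * \<rho> powr s \<and> finite (prefixes_near n z \<rho>) \<and> card (prefixes_near n z \<rho>) \<le> 4"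
proof (cases "\<rho> \<le> 1")
  case True
  then obtain n where "1 / real b ^ Suc n < \<rho>" "\<rho> \<le> 1 / real b ^ n"
    using exists_scale[OF base assms] by blast
  then show ?thesis
    using scale_powr_le card_prefixes_near by blast
next
  case False
  \<comment> \<open>For a radius above 1 level 0 suffices: the only prefix is the empty word, and
    \<open>\<rho> powr s \<ge> 1\<close>.\<close>
  then have "1 * 1 \<le> \<beta> * \<rho> powr s"
    using beta s_pos by (intro mult_mono ge_one_powr_ge_zero) auto
  moreover have "prefixes_near 0 z \<rho> \<subseteq> {[]}" by auto
  ultimately show ?thesis
    using card_mono[of "{[]}" "prefixes_near 0 z \<rho>"] finite_subset[of "prefixes_near 0 z \<rho>" "{[]}"]
    by (intro exI[of _ 0]) auto
qed

text \<open>The mass distribution principle in finite form. Ball \<open>i\<close> meets at most four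
  words at its own level \<open>n i\<close>, which carry mass at most
  \<open>4 / \<beta> ^ n i\<close>, and the mass of \<open>u\<close> is at most the sum of these.
  All masses are compared at one common level \<open>N\<close>.\<close>

lemma finite_ball_cover:
  assumes u: "u \<in> T" and I: "finite I" and \<rho>: "\<And>i. i \<in> I \<Longrightarrow> 0 < \<rho> i"
    and cover: "cylinder u \<subseteq> (\<Union>i\<in>I. ball (z i) (\<rho> i))"
  shows "c / \<beta> ^ length u \<le> 4 * \<beta> * (\<Sum>i\<in>I. \<rho> i powr s)"
proof -
  have "\<forall>i\<in>I. \<exists>n. 1 / \<beta> ^ n \<le> \<beta> * \<rho> i powr s \<and> finite (prefixes_near n (z i) (\<rho> i))
      \<and> card (prefixes_near n (z i) (\<rho> i)) \<le> 4"
    by (intro ballI exists_scale_near \<rho>)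
  from bchoice[OF this] obtain n where n: "\<And>i. i \<in> I \<Longrightarrow> 1 / \<beta> ^ n i \<le> \<beta> * \<rho> i powr s"
    "\<And>i. i \<in> I \<Longrightarrow> finite (prefixes_near (n i) (z i) (\<rho> i))"
    "\<And>i. i \<in> I \<Longrightarrow> card (prefixes_near (n i) (z i) (\<rho> i)) \<le> 4"
    by auto
  define V where "V i = prefixes_near (n i) (z i) (\<rho> i)" for i
  \<comment> \<open>The sum is a crude upper bound for all the \<open>n i\<close>, so that level
    \<open>N\<close> lies below every level in use.\<close>
  define k where "k = (\<Sum>i\<in>I. n i)"
  define N where "N = length u + k"
  have nN: "n i \<le> N" if "i \<in> I" for i
    unfolding N_def k_def using member_le_sum[OF that _ I, of n] by simp
  have VT: "v \<in> T" "length v = n i" if "v \<in> V i" for v i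
    using prefixes_near_in[of v "n i" "z i" "\<rho> i"] that unfolding V_def by simp_all
  have fin: "finite (\<Union>v\<in>V i. extensions v (N - n i))" if "i \<in> I" for i
    using n(2)[OF that] VT finite_extensions unfolding V_def[symmetric] by (intro finite_UN_I) auto
  have sub: "extensions u k \<subseteq> (\<Union>i\<in>I. \<Union>v\<in>V i. extensions v (N - n i))"
  proof
    fix w assume w: "w \<in> extensions u k"
    then have wT: "w \<in> T" and lw: "length w = N" and tw: "take (length u) w = u"
      by (auto simp: extensions_def N_def)
    \<comment> \<open>A deep word is continued to a path; the ball containing the value of that path
      tells from which prefix the word descends.\<close>
    obtain d where d: "d \<in> paths" "map d [0..<N] = w"
      using exists_path[OF wT] lw by auto
    have "map d [0..<length u] = u"
      using tw d(2) by (auto simp: N_def take_map)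
    then have "base_value b d \<in> cylinder u"
      using d(1) by (auto simp: cylinder_def)
    then obtain i where i: "i \<in> I" "base_value b d \<in> ball (z i) (\<rho> i)"
      using cover by auto
    let ?v = "map d [0..<n i]"
    have "?v \<in> V i"
      using d(1) i(2) unfolding V_def by (intro imageI) auto
    moreover have "w \<in> extensions ?v (N - n i)"
      using wT lw nN[OF i(1)] by (simp add: extensions_def d(2)[symmetric] take_map)
    ultimately show "w \<in> (\<Union>i\<in>I. \<Union>v\<in>V i. extensions v (N - n i))"
      using i(1) by (intro UN_I)
  qed
  have pos: "0 \<le> \<phi> w" if "w \<in> T" for w
    using weight_pos[OF that] by simp
  have "\<beta> ^ k * c \<le> \<beta> ^ k * \<phi> u"
    using weight_ge[OF u] beta by (intro mult_left_mono) auto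
  also have "\<dots> = (\<Sum>w\<in>extensions u k. \<phi> w)"
    by (simp add: sum_extensions[OF u])
  also have "\<dots> \<le> (\<Sum>w\<in>(\<Union>i\<in>I. \<Union>v\<in>V i. extensions v (N - n i)). \<phi> w)"
    using fin I by (intro sum_mono2 sub) (auto simp: extensions_def intro!: pos)
  also have "\<dots> \<le> (\<Sum>i\<in>I. \<Sum>w\<in>(\<Union>v\<in>V i. extensions v (N - n i)). \<phi> w)"
    using fin I by (intro sum_UN_le_sum) (auto simp: extensions_def intro!: pos)
  also have "\<dots> \<le> (\<Sum>i\<in>I. \<Sum>v\<in>V i. \<Sum>w\<in>extensions v (N - n i). \<phi> w)"
  proof (intro sum_mono sum_UN_le_sum)
    fix i assume "i \<in> I"
    then show "finite (V i)" unfolding V_def by (rule n(2))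
  next
    fix v i assume "v \<in> V i"
    then show "finite (extensions v (N - n i))" by (intro finite_extensions VT)
  next
    fix v w i assume "w \<in> extensions v (N - n i)"
    then show "0 \<le> \<phi> w" by (intro pos) (simp add: extensions_def)
  qed
  also have "\<dots> \<le> (\<Sum>i\<in>I. \<Sum>v\<in>V i. \<beta> ^ (N - n i) * 1)"
    using VT weight_le beta by (intro sum_mono) (simp add: sum_extensions)
  also have "\<dots> \<le> (\<Sum>i\<in>I. 4 * \<beta> ^ (N - n i))"
    using n(3) beta unfolding V_def[symmetric] by (intro sum_mono) auto
  also have "\<dots> = (\<Sum>i\<in>I. 4 * \<beta> ^ N * (1 / \<beta> ^ n i))"
    using beta nN by (intro sum.cong) (auto simp: power_diff)
  also have "\<dots> \<le> (\<Sum>i\<in>I. 4 * \<beta> ^ N * (\<beta> * \<rho> i powr s))"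
    using beta n(1) by (intro sum_mono mult_left_mono) auto
  also have "\<dots> = \<beta> ^ N * (4 * \<beta> * (\<Sum>i\<in>I. \<rho> i powr s))"
    by (simp add: sum_distrib_left mult_ac)
  finally have "\<beta> ^ k * c / \<beta> ^ N \<le> 4 * \<beta> * (\<Sum>i\<in>I. \<rho> i powr s)"
    using beta by (simp add: divide_le_eq mult.commute)
  then show ?thesis
    using beta by (simp add: N_def power_add)
qed

text \<open>Each nonempty set of the cover is enlarged to an open ball around one of its points,
  with total extra cost at most \<open>e\<close>. Compactness leaves finitely many balls, to which
  \<open>finite_ball_cover\<close> applies.\<close>

lemma cover_lower_bound:
  assumes u: "u \<in> T" and cover: "cylinder u \<subseteq> (\<Union>i. U i)" and bdd: "\<And>i :: nat. bounded (U i)"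
  shows "ennreal (c / (4 * \<beta>) / \<beta> ^ length u) \<le> (\<Sum>i. diam_powr s (U i))"
proof (rule ennreal_le_epsilon)
  fix e :: real assume e: "0 < e"
  have "\<exists>r>diameter (U i). r powr s \<le> diameter (U i) powr s + e * (1 / 2) ^ Suc i" for i
  proof -
    let ?a = "diameter (U i)"
    have a: "0 \<le> ?a" using bdd by (rule diameter_ge_0)
    \<comment> \<open>Right continuity of the power function, valid also at diameter 0 because
      \<open>s\<close> is positive.\<close>
    have "((\<lambda>r. r powr s) \<longlongrightarrow> ?a powr s) (at_right ?a)"
      using s_pos a by (intro tendsto_intros) (auto simp: eventually_at_filter)
    then have "eventually (\<lambda>r. r powr s < ?a powr s + e * (1 / 2) ^ Suc i) (at_right ?a)"
      using e by (intro order_tendstoD) auto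
    then show ?thesis
      unfolding eventually_at_right_field using dense[of ?a] by (metis less_imp_le)
  qed
  then obtain \<rho> where \<rho>: "\<And>i. diameter (U i) < \<rho> i"
    "\<And>i. \<rho> i powr s \<le> diameter (U i) powr s + e * (1 / 2) ^ Suc i"
    by metis
  have \<rho>pos: "0 < \<rho> i" for i
    using \<rho>(1)[of i] diameter_ge_0[OF bdd, of i] by linarith
  define z where "z i = (SOME x. x \<in> U i)" for i
  have z: "z i \<in> U i" if "U i \<noteq> {}" for i
    using that unfolding z_def by (simp add: some_in_eq)
  have "cylinder u \<subseteq> (\<Union>i\<in>{i. U i \<noteq> {}}. ball (z i) (\<rho> i))"
  proof
    fix x assume "x \<in> cylinder u"
    then obtain i where i: "x \<in> U i" using cover by blast
    then have "dist (z i) x \<le> diameter (U i)"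
      using z by (intro diameter_bounded_bound bdd) auto
    with \<rho>(1)[of i] i show "x \<in> (\<Union>i\<in>{i. U i \<noteq> {}}. ball (z i) (\<rho> i))"
      by (auto intro!: exI[of _ i])
  qed
  then obtain I where I: "I \<subseteq> {i. U i \<noteq> {}}" "finite I" "cylinder u \<subseteq> (\<Union>i\<in>I. ball (z i) (\<rho> i))"
    by (rule compactE_image[OF compact_cylinder, rotated]) auto
  have "ennreal (c / (4 * \<beta>) / \<beta> ^ length u) \<le> ennreal (\<Sum>i\<in>I. \<rho> i powr s)"
    using finite_ball_cover[OF u I(2) \<rho>pos I(3)] beta by (intro ennreal_leI) (simp add: field_simps)
  also have "\<dots> \<le> ennreal (\<Sum>i\<in>I. diameter (U i) powr s + e * (1 / 2) ^ Suc i)"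
    by (intro ennreal_leI sum_mono \<rho>)
  also have "\<dots> = (\<Sum>i\<in>I. diam_powr s (U i) + ennreal (e * (1 / 2) ^ Suc i))"
    using I(1) s_pos e
    by (subst sum_ennreal[symmetric]) (auto simp: diam_powr_def intro!: sum.cong)
  also have "\<dots> \<le> (\<Sum>i. diam_powr s (U i) + ennreal (e * (1 / 2) ^ Suc i))"
    using I(2) by (intro sum_le_suminf) auto
  also have "\<dots> = (\<Sum>i. diam_powr s (U i)) + (\<Sum>i. ennreal (e * (1 / 2) ^ Suc i))"
    by (intro suminf_add[symmetric]) auto
  also have "(\<Sum>i. ennreal (e * (1 / 2) ^ Suc i)) = ennreal e"
  proof -
    have "(\<lambda>i. e * (1 / 2) ^ Suc i) sums (e * 1)"
      by (intro sums_mult power_half_series)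
    then show ?thesis
      using e by (subst suminf_ennreal2) (auto simp: sums_iff)
  qed
  finally show "ennreal (c / (4 * \<beta>) / \<beta> ^ length u) \<le> (\<Sum>i. diam_powr s (U i)) + ennreal e" .
qed

lemma hausdorff_measure_ge:
  assumes "u \<in> T" "cylinder u \<subseteq> A"
  shows "ennreal (c / (4 * \<beta>) / \<beta> ^ length u) \<le> hausdorff_measure s A"
proof -
  \<comment> \<open>The bound holds for bounded covers of any mesh, so the single value
    \<open>\<delta> = 1\<close> is enough.\<close>
  have "ennreal (c / (4 * \<beta>) / \<beta> ^ length u) \<le> hausdorff_premeasure s 1 A"
    unfolding hausdorff_premeasure_def
    using assms by (intro INF_greatest cover_lower_bound) auto
  also have "\<dots> \<le> hausdorff_measure s A"
    unfolding hausdorff_measure_def by (intro SUP_upper) auto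
  finally show ?thesis .
qed

text \<open>For \<open>r\<close> between \<open>1 / b ^ Suc n\<close> and \<open>1 / b ^ n\<close>,
  the ball around \<open>x\<close> is covered by at most four cylinders of level \<open>n\<close>
  and contains the cylinder of level \<open>Suc n\<close> through \<open>x\<close>.\<close>

theorem ahlfors_regular_paths: "ahlfors_regular s (base_value b ` paths)"
proof -
  let ?K = "base_value b ` paths"
  \<comment> \<open>The second entry serves the upper estimate, the reciprocal of the third the
    lower one.\<close>
  let ?C = "max 1 (max (4 / c * \<beta>) (4 * \<beta> * \<beta> / c))"
  have "compact ?K"
    using compact_cylinder[of "[]"] by (simp add: cylinder_Nil)
  moreover have "ennreal (inverse ?C * r powr s) \<le> hausdorff_measure s (?K \<inter> cball x r)
      \<and> hausdorff_measure s (?K \<inter> cball x r) \<le> ennreal (?C * r powr s)"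
    if r: "0 < r" "r < 1" and x: "x \<in> ?K" for r x
  proof -
    obtain d where d: "d \<in> paths" "x = base_value b d" using x by auto
    obtain n where n: "1 / real b ^ Suc n < r" "r \<le> 1 / real b ^ n"
      using exists_scale[OF base r(1)] r(2) by auto
    let ?S = "prefixes_near n x r" and ?u = "map d [0..<Suc n]"
    have "?K \<inter> cball x r \<subseteq> (\<Union>u\<in>?S. cylinder u)"
    proof
      fix y assume "y \<in> ?K \<inter> cball x r"
      then obtain e where "e \<in> paths" "y = base_value b e" "base_value b e \<in> cball x r" by auto
      then show "y \<in> (\<Union>u\<in>?S. cylinder u)"
        by (intro UN_I[of "map e [0..<n]"]) (auto simp: cylinder_def)
    qed
    then have "hausdorff_measure s (?K \<inter> cball x r) \<le> ennreal (4 / c / \<beta> ^ n)"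
      by (intro hausdorff_measure_cylinders_le[of ?S] card_prefixes_near[OF n(2)] prefixes_near_in)
    also have "4 / c / \<beta> ^ n \<le> ?C * r powr s"
    proof -
      have "4 / c * (1 / \<beta> ^ n) \<le> 4 / c * (\<beta> * r powr s)"
        using scale_powr_le[OF n(1)] c by (intro mult_left_mono) auto
      also have "\<dots> \<le> ?C * r powr s"
        unfolding mult.assoc[symmetric] by (intro mult_right_mono) auto
      finally show ?thesis by simp
    qed
    finally have upper: "hausdorff_measure s (?K \<inter> cball x r) \<le> ennreal (?C * r powr s)"
      by (simp add: ennreal_leI)
    have u: "?u \<in> T" "length ?u = Suc n"
      using d(1) unfolding paths_def mem_Collect_eq by (rule spec) simp
    have xu: "x \<in> cylinder ?u"
      using d by (auto simp: cylinder_def)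
    have "cylinder ?u \<subseteq> ?K \<inter> cball x r"
    proof
      fix y assume y: "y \<in> cylinder ?u"
      have "\<bar>x - y\<bar> < r"
        using cylinder_dist[OF xu y] n(1) unfolding u(2) by linarith
      with y show "y \<in> ?K \<inter> cball x r"
        by (auto simp: cylinder_def dist_real_def)
    qed
    from hausdorff_measure_ge[OF u(1) this]
    have "ennreal (c / (4 * \<beta>) / \<beta> ^ Suc n) \<le> hausdorff_measure s (?K \<inter> cball x r)"
      unfolding u(2) .
    moreover have "inverse ?C * r powr s \<le> c / (4 * \<beta>) / \<beta> ^ Suc n"
    proof -
      have "inverse ?C \<le> inverse (4 * \<beta> * \<beta> / c)"
        using beta c by (intro le_imp_inverse_le) auto
      moreover have "r powr s \<le> 1 / \<beta> ^ n"
        unfolding base_powr_s[symmetric] using n(2) r(1) s_pos by (intro powr_mono2) auto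
      ultimately have "inverse ?C * r powr s \<le> inverse (4 * \<beta> * \<beta> / c) * (1 / \<beta> ^ n)"
        using beta c by (intro mult_mono) auto
      also have "\<dots> = c / (4 * \<beta>) / \<beta> ^ Suc n"
        using beta c by (simp add: field_simps)
      finally show ?thesis .
    qed
    ultimately show ?thesis
      using upper ennreal_leI order_trans by blast
  qed
  ultimately show ?thesis
    unfolding ahlfors_regular_def
    by (intro conjI exI[of _ ?C] allI impI) (simp_all only: max.cobounded1)
qed

end

section \<open>Words avoiding forbidden words\<close>

definition avoiding_words :: "nat \<Rightarrow> nat \<Rightarrow> (nat \<Rightarrow> nat list) \<Rightarrow> nat list set" where
  "avoiding_words b m \<omega> =
     {u. set u \<subseteq> {..<b} \<and> (\<forall>k. k + m \<le> length u \<longrightarrow> take m (drop k u) \<noteq> \<omega> k)}"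

text \<open>The last \<open>r\<close> letters begin the forbidden word that starts at position
  \<open>length u - r\<close>. For \<open>r = m\<close> such a word has just been completed. The
  guard \<open>r \<le> length u\<close> protects against truncated subtraction.\<close>

definition partial_match :: "(nat \<Rightarrow> nat list) \<Rightarrow> nat list \<Rightarrow> nat \<Rightarrow> bool" where
  "partial_match \<omega> u r \<longleftrightarrow>
     r \<le> length u \<and> drop (length u - r) u = take r (\<omega> (length u - r))"

lemma partial_match_0 [simp]: "partial_match \<omega> u 0"
  by (simp add: partial_match_def)

text \<open>Word and match grow together, so the starting position and hence the relevant forbidden
  word stay the same.\<close>

lemma partial_match_snoc:
  assumes "r < length (\<omega> (length u - r))"
  shows "partial_match \<omega> (u @ [x]) (Suc r) \<longleftrightarrow> partial_match \<omega> u r \<and> x = \<omega> (length u - r) ! r"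
  using assms by (auto simp: partial_match_def take_Suc_conv_app_nth)

text \<open>The only new window of length \<open>m\<close> is the one ending at the appended
  letter.\<close>

lemma avoiding_words_snoc:
  assumes "\<And>k. length (\<omega> k) = m"
  shows "u @ [x] \<in> avoiding_words b m \<omega> \<longleftrightarrow>
    u \<in> avoiding_words b m \<omega> \<and> x < b \<and> \<not> partial_match \<omega> (u @ [x]) m"
proof -
  let ?P = "\<lambda>v k. k + m \<le> length v \<longrightarrow> take m (drop k v) \<noteq> \<omega> k"
  have old: "?P (u @ [x]) k \<longleftrightarrow> ?P u k" if "k + m \<noteq> length (u @ [x])" for k
    using that by (auto simp: le_Suc_eq)
  have new: "(\<forall>k. k + m = length (u @ [x]) \<longrightarrow> ?P (u @ [x]) k) \<longleftrightarrow> \<not> partial_match \<omega> (u @ [x]) m"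
  proof (cases "m \<le> length (u @ [x])")
    case True
    then have "k + m = length (u @ [x]) \<longleftrightarrow> k = length (u @ [x]) - m" for k by auto
    with True show ?thesis
      using assms by (auto simp: partial_match_def)
  qed (auto simp: partial_match_def)
  have none: "?P u k" if "k + m = length (u @ [x])" for k
    using that by simp
  have "(\<forall>k. ?P (u @ [x]) k) \<longleftrightarrow> (\<forall>k. ?P u k) \<and> \<not> partial_match \<omega> (u @ [x]) m"
    using old new none by blast
  then show ?thesis
    unfolding avoiding_words_def mem_Collect_eq by auto
qed

lemma avoiding_words_not_partial_match:
  assumes "u \<in> avoiding_words b m \<omega>" "length (\<omega> (length u - m)) = m"
  shows "\<not> partial_match \<omega> u m"
  using assms by (auto simp: avoiding_words_def partial_match_def dest!: spec[of _ "length u - m"])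

lemma K_set_eq:
  "K_set b m \<omega> = base_value b ` {d. \<forall>n. map d [0..<n] \<in> avoiding_words b m \<omega>}"
proof -
  let ?A = "avoiding_words b m \<omega>"
  have sub: "map d [k..<k + m] = take m (drop k (map d [0..<n]))" if "k + m \<le> n" for d :: "nat \<Rightarrow> nat" and k n
    using that by (simp add: drop_map take_map drop_upt take_upt)
  have paths: "(\<forall>n. map d [0..<n] \<in> ?A) \<longleftrightarrow> (\<forall>i. d i < b) \<and> (\<forall>k. map d [k..<k + m] \<noteq> \<omega> k)"
    for d :: "nat \<Rightarrow> nat"
  proof
    assume d: "\<forall>n. map d [0..<n] \<in> ?A"
    have "d i < b" for i
      using spec[OF d, of "Suc i"] by (auto simp: avoiding_words_def)
    moreover have "map d [k..<k + m] \<noteq> \<omega> k" for k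
    proof -
      have "\<forall>j. j + m \<le> length (map d [0..<k + m]) \<longrightarrow> take m (drop j (map d [0..<k + m])) \<noteq> \<omega> j"
        using spec[OF d, of "k + m"] unfolding avoiding_words_def by blast
      from spec[OF this, of k] show ?thesis
        unfolding sub[OF order.refl] by simp
    qed
    ultimately show "(\<forall>i. d i < b) \<and> (\<forall>k. map d [k..<k + m] \<noteq> \<omega> k)" by blast
  next
    assume d: "(\<forall>i. d i < b) \<and> (\<forall>k. map d [k..<k + m] \<noteq> \<omega> k)"
    show "\<forall>n. map d [0..<n] \<in> ?A"
      unfolding avoiding_words_def mem_Collect_eq
    proof (intro allI conjI impI)
      fix n k assume "k + m \<le> length (map d [0..<n])"
      then have "k + m \<le> n" by simp
      moreover have "map d [k..<k + m] \<noteq> \<omega> k" using d by blast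
      ultimately show "take m (drop k (map d [0..<n])) \<noteq> \<omega> k"
        using sub[of k n d] by metis
    qed (use d in auto)
  qed
  have shift: "map d [k + 1..<k + m + 1] = map (d \<circ> Suc) [k..<k + m]" for d :: "nat \<Rightarrow> nat" and k
    by (simp add: map_Suc_upt[symmetric] del: upt_Suc)
  show ?thesis
    unfolding paths
  proof (intro set_eqI iffI)
    fix x assume "x \<in> K_set b m \<omega>"
    then obtain d where d: "x = (\<Sum>i. real (d (Suc i)) / real b ^ Suc i)" "\<forall>i\<ge>1. d i < b"
      "\<forall>k. map d [k + 1..<k + m + 1] \<noteq> \<omega> k"
      unfolding K_set_def by blast
    then have "x = base_value b (d \<circ> Suc)" "\<forall>i. (d \<circ> Suc) i < b"
      "\<forall>k. map (d \<circ> Suc) [k..<k + m] \<noteq> \<omega> k"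
      unfolding shift by (simp_all add: base_value_def)
    then show "x \<in> base_value b ` {d. (\<forall>i. d i < b) \<and> (\<forall>k. map d [k..<k + m] \<noteq> \<omega> k)}"
      by blast
  next
    fix x assume "x \<in> base_value b ` {d. (\<forall>i. d i < b) \<and> (\<forall>k. map d [k..<k + m] \<noteq> \<omega> k)}"
    then obtain d where d: "x = base_value b d" "\<forall>i. d i < b" "\<forall>k. map d [k..<k + m] \<noteq> \<omega> k"
      by blast
    \<comment> \<open>The shift back to digits indexed from 1; truncated subtraction gives
      \<open>e 0 = d 0\<close> as default value.\<close>
    define e where "e i = d (i - 1)" for i
    have "e \<circ> Suc = d" by (auto simp: e_def)
    then have "x = (\<Sum>i. real (e (Suc i)) / real b ^ Suc i)" "\<forall>i\<ge>1. e i < b"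
      "\<forall>k. map e [k + 1..<k + m + 1] \<noteq> \<omega> k"
      unfolding shift using d by (simp_all add: base_value_def e_def)
    then show "x \<in> K_set b m \<omega>"
      unfolding K_set_def by blast
  qed
qed

text \<open>
  The weight of a partial match grows by the factor \<open>\<beta>\<close> with each further matched letter, so
  summing over the children of \<open>u\<close> multiplies \<open>1 - weights\<close> by \<open>\<beta>\<close>; the hypothesis \<open>dead\<close> says that
  completing a forbidden word uses up the whole weight.
\<close>

lemma ahlfors_regular_if_weights:
  fixes x :: "nat \<Rightarrow> real"
  assumes b: "2 \<le> b" and m: "1 \<le> m" and \<beta>: "1 < \<beta>"
    and \<omega>: "\<And>k. \<omega> k \<in> words b m"
    and x: "\<And>r. 0 \<le> x r" "x 1 = real b - \<beta>" "\<And>r. x (Suc r) = \<beta> * x r"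
    and small: "(\<Sum>r\<in>{1..<m}. x r) < 1"
    and dead: "\<And>u. partial_match \<omega> u m \<Longrightarrow> (\<Sum>r | r \<in> {1..m} \<and> partial_match \<omega> u r. x r) = 1"
  shows "ahlfors_regular (ln \<beta> / ln (real b)) (K_set b m \<omega>)"
proof -
  let ?T = "avoiding_words b m \<omega>"
  define \<phi> where "\<phi> u = 1 - (\<Sum>r | r \<in> {1..m} \<and> partial_match \<omega> u r. x r)" for u
  have len: "length (\<omega> k) = m" for k
    using \<omega>[of k] by (simp add: words_def)
  have digit: "\<omega> k ! r < b" if "r < m" for k r
    using \<omega>[of k] that nth_mem[of r "\<omega> k"] by (auto simp: words_def simp del: nth_mem)
  \<comment> \<open>An admissible word has no complete match, so \<open>r = m\<close> drops out;
    this is why the lower bound on the weights involves only \<open>r < m\<close>.\<close>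
  have phi_eq: "\<phi> u = 1 - (\<Sum>r\<in>{1..<m}. of_bool (partial_match \<omega> u r) * x r)" if "u \<in> ?T" for u
  proof -
    have "{r. r \<in> {1..m} \<and> partial_match \<omega> u r} = {r \<in> {1..<m}. partial_match \<omega> u r}"
      using avoiding_words_not_partial_match[OF that len] by (auto simp: le_less)
    then show ?thesis
      by (simp add: \<phi>_def sum_of_bool_mult_eq Int_def)
  qed
  interpret weighted_word_tree b ?T \<phi> \<beta> "1 - (\<Sum>r\<in>{1..<m}. x r)"
  proof
    show "[] \<in> ?T"
      using m len[of 0] by (auto simp: avoiding_words_def)
    show "u \<in> ?T \<and> x < b" if "u @ [x] \<in> ?T" for u x
      using that avoiding_words_snoc[of \<omega> m, OF len] by blast
    show "1 - (\<Sum>r\<in>{1..<m}. x r) \<le> \<phi> u" if "u \<in> ?T" for u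
      unfolding phi_eq[OF that] using x(1) by (intro diff_left_mono sum_mono) auto
    show "\<phi> u \<le> 1" if "u \<in> ?T" for u
      unfolding \<phi>_def using x(1) by (simp add: sum_nonneg)
    show "(\<Sum>y | y < b \<and> u @ [y] \<in> ?T. \<phi> (u @ [y])) = \<beta> * \<phi> u" if u: "u \<in> ?T" for u
    proof -
      let ?p = "\<lambda>r. of_bool (partial_match \<omega> u r) :: real"
      \<comment> \<open>Exactly one digit prolongs a given partial match.\<close>
      have one: "(\<Sum>y<b. of_bool (partial_match \<omega> (u @ [y]) (Suc r))) = ?p r" if "r < m" for r
      proof -
        have "(\<Sum>y<b. of_bool (partial_match \<omega> (u @ [y]) (Suc r)))
            = (\<Sum>y<b. if y = \<omega> (length u - r) ! r then ?p r else 0)"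
          using that len by (intro sum.cong) (auto simp: partial_match_snoc)
        then show ?thesis
          using digit[OF that] by simp
      qed
      \<comment> \<open>Inadmissible children may be added to the sum: they complete a forbidden
        word, so \<open>dead\<close> gives them weight 0.\<close>
      have "(\<Sum>y | y < b \<and> u @ [y] \<in> ?T. \<phi> (u @ [y])) = (\<Sum>y<b. \<phi> (u @ [y]))"
        using u dead by (intro sum.mono_neutral_left)
          (auto simp: avoiding_words_snoc[of \<omega> m, OF len] \<phi>_def)
      also have "\<dots> = (\<Sum>y<b. 1 - (\<Sum>r<m. of_bool (partial_match \<omega> (u @ [y]) (Suc r)) * x (Suc r)))"
      proof (rule sum.cong)
        fix y
        have "(\<Sum>r | r \<in> {1..m} \<and> partial_match \<omega> (u @ [y]) r. x r)
            = (\<Sum>r\<in>{1..m}. of_bool (partial_match \<omega> (u @ [y]) r) * x r)"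
          by (simp add: sum_of_bool_mult_eq Int_def)
        also have "\<dots> = (\<Sum>r<m. of_bool (partial_match \<omega> (u @ [y]) (Suc r)) * x (Suc r))"
          by (rule sum.reindex_bij_witness[of _ Suc "\<lambda>r. r - 1"]) auto
        finally show "\<phi> (u @ [y]) = 1 - (\<Sum>r<m. of_bool (partial_match \<omega> (u @ [y]) (Suc r)) * x (Suc r))"
          by (simp add: \<phi>_def)
      qed simp
      also have "\<dots> = real b - (\<Sum>r<m. (\<Sum>y<b. of_bool (partial_match \<omega> (u @ [y]) (Suc r))) * x (Suc r))"
        unfolding sum_subtractf sum_distrib_right by (subst sum.swap) simp
      also have "\<dots> = real b - (\<Sum>r<m. ?p r * x (Suc r))"
        using one by simp
      \<comment> \<open>The empty match is always present and contributes
        \<open>x 1 = b - \<beta>\<close>, which turns the constant \<open>b\<close> into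
        \<open>\<beta>\<close>.\<close>
      also have "(\<Sum>r<m. ?p r * x (Suc r)) = x 1 + (\<Sum>r\<in>{1..<m}. ?p r * x (Suc r))"
        using m unfolding lessThan_atLeast0 by (subst sum.atLeast_Suc_lessThan) auto
      also have "\<dots> = x 1 + \<beta> * (\<Sum>r\<in>{1..<m}. ?p r * x r)"
        unfolding x(3) sum_distrib_left by (simp only: mult.left_commute)
      also have "real b - \<dots> = \<beta> * \<phi> u"
        unfolding phi_eq[OF u] x(2) by (simp add: algebra_simps)
      finally show ?thesis .
    qed
  qed (use b \<beta> small in auto)
  show ?thesis
    using ahlfors_regular_paths unfolding paths_def K_set_eq .
qed

section \<open>Partial matches under the two overlap conditions\<close>

text \<open>If \<open>u\<close> ends with a whole forbidden word, its last \<open>r\<close> letters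
  are the end of that word. The match then compares two forbidden words, in the form of the overlap
  conditions at position \<open>length u - r\<close> with \<open>j = m - r\<close>.\<close>

lemma partial_match_if_complete:
  assumes "partial_match \<omega> u m" "length (\<omega> (length u - m)) = m" "r \<le> m"
  shows "partial_match \<omega> u r \<longleftrightarrow>
    take r (\<omega> (length u - r)) = drop (m - r) (\<omega> (length u - r - (m - r)))"
proof -
  have m: "m \<le> length u" "drop (length u - m) u = \<omega> (length u - m)"
    using assms by (auto simp: partial_match_def)
  have "drop (length u - r) u = drop (m - r) (drop (length u - m) u)"
    using m(1) assms(3) by simp
  then show ?thesis
    using m assms(3) by (auto simp: partial_match_def)
qed

lemma partial_match_progressively_overlapping:
  assumes "progressively_overlapping m \<omega>" "partial_match \<omega> u m" "length (\<omega> (length u - m)) = m"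
    and "r \<in> {1..m}"
  shows "partial_match \<omega> u r"
proof (cases "r = m")
  case False
  have "m \<le> length u" using assms(2) by (simp add: partial_match_def)
  then have "progressively_overlapping_at m \<omega> (length u - r)"
    using assms(1,4) False by (auto simp: progressively_overlapping_def)
  from this[unfolded progressively_overlapping_at_def, THEN spec, of "m - r"]
  have "take (m - (m - r)) (\<omega> (length u - r)) = drop (m - r) (\<omega> (length u - r - (m - r)))"
    by (rule mp) (use assms(4) False \<open>m \<le> length u\<close> in auto)
  then show ?thesis
    using partial_match_if_complete[OF assms(2,3), of r] assms(4) by simp
qed (use assms in simp)

lemma partial_match_totally_distinct:
  assumes "totally_distinct m \<omega>" "partial_match \<omega> u m" "length (\<omega> (length u - m)) = m"
    and "r \<in> {1..m}" "partial_match \<omega> u r"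
  shows "r = m"
proof (rule ccontr)
  assume "r \<noteq> m"
  have "m \<le> length u" using assms(2) by (simp add: partial_match_def)
  then have "totally_distinct_at m \<omega> (length u - r)"
    using assms(1,4) \<open>r \<noteq> m\<close> by (auto simp: totally_distinct_def)
  from this[unfolded totally_distinct_at_def, THEN spec, of "m - r"]
  have "take (m - (m - r)) (\<omega> (length u - r)) \<noteq> drop (m - r) (\<omega> (length u - r - (m - r)))"
    by (rule mp) (use assms(4) \<open>r \<noteq> m\<close> \<open>m \<le> length u\<close> in auto)
  then show False
    using partial_match_if_complete[OF assms(2,3), of r] assms(4,5) by simp
qed

lemma ahlfors_regular_progressively_overlapping:
  fixes lam :: real
  assumes b: "3 \<le> b" and m: "2 \<le> m" and \<omega>: "\<And>k. \<omega> k \<in> words b m"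
    and over: "progressively_overlapping m \<omega>" and lam: "real b - 1 < lam"
    and eq: "lam ^ m - (real b - 1) * (\<Sum>i<m. lam ^ i) = 0"
  shows "ahlfors_regular (ln lam / ln (real b)) (K_set b m \<omega>)"
proof -
  \<comment> \<open>Completing a forbidden word completes matches of all lengths 1 to
    \<open>m\<close>, so \<open>dead\<close> asks that all \<open>m\<close> weights sum to 1. The
    defining equation makes this normalization correct.\<close>
  define x where "x r = (real b - 1) * lam ^ r / lam ^ Suc m" for r
  have pos: "0 < lam" "1 < lam" using lam b by auto
  have total: "(\<Sum>r\<in>{1..m}. x r) = 1"
  proof -
    have "(\<Sum>r\<in>{1..m}. x r) = (\<Sum>i<m. x (Suc i))"
      by (rule sum.reindex_bij_witness[of _ Suc "\<lambda>r. r - 1"]) auto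
    also have "\<dots> = (real b - 1) * (\<Sum>i<m. lam ^ i) / lam ^ m"
      using pos by (simp add: x_def sum_distrib_left sum_divide_distrib)
    also have "(real b - 1) * (\<Sum>i<m. lam ^ i) = lam ^ m"
      using eq by simp
    also have "lam ^ m / lam ^ m = 1"
      using pos by simp
    finally show ?thesis .
  qed
  have len: "length (\<omega> k) = m" for k
    using \<omega>[of k] by (simp add: words_def)
  show ?thesis
  proof (rule ahlfors_regular_if_weights[where x = x])
    show "x 1 = real b - lam"
    proof -
      \<comment> \<open>The defining equation times \<open>lam - 1\<close>, which removes the
        geometric sum.\<close>
      have "lam ^ m * (lam - 1) = (real b - 1) * (lam ^ m - 1)"
        using eq power_diff_1_eq[of lam m] by (simp add: mult_ac)
      then have "real b - 1 = (real b - lam) * lam ^ m"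
        by (simp add: algebra_simps)
      then have "(real b - 1) * lam = (real b - lam) * lam ^ Suc m"
        by simp
      then show ?thesis
        using pos by (simp add: x_def nonzero_divide_eq_eq)
    qed
    have "(\<Sum>r\<in>{1..m}. x r) = (\<Sum>r\<in>{1..<m}. x r) + x m"
      using m by (simp add: sum.last_plus add.commute)
    moreover have "0 < x m" using pos b by (simp add: x_def)
    ultimately show "(\<Sum>r\<in>{1..<m}. x r) < 1" using total by linarith
    fix u assume u: "partial_match \<omega> u m"
    have "{r. r \<in> {1..m} \<and> partial_match \<omega> u r} = {1..m}"
      using partial_match_progressively_overlapping[OF over u len] by blast
    then show "(\<Sum>r | r \<in> {1..m} \<and> partial_match \<omega> u r. x r) = 1"
      using total by simp
  qed (use b m pos \<omega> in \<open>auto simp: x_def\<close>)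
qed

lemma ahlfors_regular_totally_distinct:
  fixes \<eta> :: real
  assumes b: "3 \<le> b" and m: "2 \<le> m" and \<omega>: "\<And>k. \<omega> k \<in> words b m"
    and dist: "totally_distinct m \<omega>" and \<eta>: "real b - 1 < \<eta>"
    and eq: "\<eta> ^ m - real b * \<eta> ^ (m - 1) + 1 = 0"
  shows "ahlfors_regular (ln \<eta> / ln (real b)) (K_set b m \<omega>)"
proof -
  \<comment> \<open>Here a completed word leaves only the match of length \<open>m\<close>, so
    \<open>dead\<close> asks for \<open>x m = 1\<close>.\<close>
  define x where "x r = \<eta> ^ r / \<eta> ^ m" for r
  have pos: "0 < \<eta>" "2 < \<eta>" using \<eta> b by auto
  have len: "length (\<omega> k) = m" for k
    using \<omega>[of k] by (simp add: words_def)
  show ?thesis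
  proof (rule ahlfors_regular_if_weights[where x = x])
    show "x 1 = real b - \<eta>"
    proof -
      obtain n where n: "m = Suc n" using m by (cases m) auto
      have "1 = (real b - \<eta>) * \<eta> ^ n"
        using eq by (simp add: n algebra_simps)
      then show ?thesis
        using pos by (simp add: x_def n nonzero_divide_eq_eq)
    qed
    \<comment> \<open>The term \<open>r = 0\<close> is added to get a full geometric sum, which
      stays below 1 since \<open>\<eta> - 1 > 1\<close>.\<close>
    have "(\<Sum>r\<in>{1..<m}. x r) \<le> (\<Sum>r<m. x r)"
      using pos by (intro sum_mono2) (auto simp: x_def)
    also have "\<dots> = (\<eta> ^ m - 1) / (\<eta> - 1) / \<eta> ^ m"
      using pos by (simp add: x_def sum_divide_distrib[symmetric] geometric_sum)
    also have "\<dots> < 1"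
    proof -
      have "(\<eta> ^ m - 1) / (\<eta> - 1) \<le> (\<eta> ^ m - 1) / 1"
        using pos by (intro divide_left_mono) auto
      also have "\<dots> < \<eta> ^ m" by simp
      finally have "(\<eta> ^ m - 1) / (\<eta> - 1) < \<eta> ^ m" .
      with pos show ?thesis by (subst divide_less_eq_1_pos) auto
    qed
    finally show "(\<Sum>r\<in>{1..<m}. x r) < 1" .
    fix u assume u: "partial_match \<omega> u m"
    have "{r. r \<in> {1..m} \<and> partial_match \<omega> u r} = {m}"
      using partial_match_totally_distinct[OF dist u len] u m by force
    then show "(\<Sum>r | r \<in> {1..m} \<and> partial_match \<omega> u r. x r) = 1"
      using pos by (simp add: x_def)
  qed (use b m pos \<omega> in \<open>auto simp: x_def\<close>)
qed

section \<open>The Pisot numbers\<close>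

lemma map_poly_of_rat_add:
  "map_poly of_rat (p + q) = (map_poly of_rat p + map_poly of_rat q :: complex poly)"
  by (rule poly_eqI) (simp add: coeff_map_poly of_rat_add)

lemma map_poly_of_rat_mult:
  "map_poly of_rat (p * q) = (map_poly of_rat p * map_poly of_rat q :: complex poly)"
  by (rule poly_eqI) (simp add: coeff_map_poly coeff_mult of_rat_sum of_rat_mult)

text \<open>If the irreducible polynomial of \<open>x\<close> did not divide \<open>q\<close>, the
  two would be coprime, and a Bezout identity evaluated at \<open>x\<close> would read
  \<open>0 = 1\<close>.\<close>

lemma algebraic_conjugate_root:
  assumes "algebraic_conjugate x z" and "poly (map_poly of_rat q) x = 0"
  shows "poly (map_poly of_rat q) z = 0"
proof -
  obtain p :: "rat poly" where p: "irreducible p" "poly (map_poly of_rat p) x = 0"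
    "poly (map_poly of_rat p) z = 0"
    using assms(1) by (auto simp: algebraic_conjugate_def)
  have "p dvd q"
  proof (rule ccontr)
    assume "\<not> p dvd q"
    with irreducible_imp_prime_elem[OF p(1)] have "coprime p q"
      by (rule prime_elem_imp_coprime)
    then obtain u v where "u * p + v * q = 1"
      by (metis bezout_coefficients_fst_snd coprime_iff_gcd_eq_1)
    then have "map_poly of_rat (u * p + v * q) = (1 :: complex poly)"
      by simp
    then have "poly (map_poly of_rat (u * p + v * q)) x = 1"
      by simp
    then show False
      using p(2) assms(2) by (simp add: map_poly_of_rat_add map_poly_of_rat_mult)
  qed
  then show ?thesis
    using p(3) by (auto simp: map_poly_of_rat_mult)
qed

lemma pisot_if_dominant_root:
  fixes p :: "int poly" and x :: real
  assumes "lead_coeff p = 1" "poly (map_poly of_int p) x = 0" "1 < x"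
    and dominant: "\<And>z :: complex. \<lbrakk>poly (map_poly of_int p) z = 0; 1 \<le> cmod z\<rbrakk> \<Longrightarrow> z = of_real x"
  shows "pisot x"
  unfolding pisot_def
proof (intro conjI allI impI)
  show "algebraic_int x"
    using assms(1,2) algebraic_int_altdef_ipoly by blast
  fix z assume z: "algebraic_conjugate (of_real x) z \<and> z \<noteq> of_real x"
  let ?q = "map_poly of_int p :: rat poly"
  have q: "map_poly of_rat ?q = (map_poly of_int p :: complex poly)"
    by (rule poly_eqI) (simp add: coeff_map_poly)
  have "poly (map_poly of_int p) (of_real x :: complex) = of_real (poly (map_poly of_int p) x)"
    by (simp add: poly_altdef coeff_map_poly degree_map_poly)
  then have "poly (map_poly of_rat ?q) (of_real x :: complex) = 0"
    using assms(2) q by simp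
  then have "poly (map_poly of_int p) z = 0"
    using algebraic_conjugate_root[of "of_real x" z ?q] z q by simp
  then show "cmod z < 1"
    using dominant z by fastforce
qed (use assms in auto)

lemma poly_map_of_int_monom:
  "poly (map_poly of_int (monom a n :: int poly)) (x :: 'a :: comm_ring_1) = of_int a * x ^ n"
  by (simp add: map_poly_monom poly_monom)

lemma map_poly_of_int_add:
  "map_poly of_int (p + q) = (map_poly of_int p + map_poly of_int q :: 'a :: ring_1 poly)"
  by (rule poly_eqI) (simp add: coeff_map_poly)

lemma map_poly_of_int_sum:
  "map_poly of_int (\<Sum>i\<in>A. p i) = (\<Sum>i\<in>A. map_poly of_int (p i) :: 'a :: ring_1 poly)"
  by (rule poly_eqI) (simp add: coeff_map_poly coeff_sum)

lemma lead_coeff_monic: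
  assumes "degree q < m"
  shows "lead_coeff (monom 1 m + q :: int poly) = 1"
proof -
  have "degree (monom 1 m + q) = m"
    using assms by (subst degree_add_eq_left) (simp_all add: degree_monom_eq)
  then show ?thesis using assms by (simp add: coeff_eq_0)
qed

text \<open>
  For \<open>w = 1 / z\<close> and \<open>u = 1 / lam\<close>, the equation times \<open>x - 1\<close> reads
  \<open>b w = 1 + (b - 1) w ^ Suc m\<close>, likewise for \<open>u\<close>. Dividing the difference by \<open>w - u\<close> gives
  \<open>(b - 1) * (\<Sum>i\<le>m. w ^ i * u ^ (m - i)) = b\<close>, and \<open>w = 1\<close> is a solution of this. Hence the
  triangle inequality is an equality and forces \<open>w = 1\<close>, which is not a root.
\<close>

lemma overlap_root_unique:
  fixes b m :: nat and lam :: real and z :: complex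
  assumes b: "2 \<le> b" and m: "1 \<le> m"
    and lam: "1 < lam" "lam ^ m = (real b - 1) * (\<Sum>i<m. lam ^ i)"
    and z: "z ^ m = (of_nat b - 1) * (\<Sum>i<m. z ^ i)" "1 \<le> cmod z"
  shows "z = of_real lam"
proof (rule ccontr)
  assume "z \<noteq> of_real lam"
  have z1: "z \<noteq> 1"
  proof
    assume "z = 1"
    then have "(1 :: complex) = of_nat ((b - 1) * m)"
      using z(1) b by (simp add: of_nat_diff)
    then have "(b - 1) * m = 1"
      by (metis of_nat_1 of_nat_eq_iff)
    \<comment> \<open>In this case the equation for \<open>lam\<close> reads \<open>lam = 1\<close>,
      against \<open>1 < lam\<close>.\<close>
    then have "b = 2" "m = 1" using b by auto
    with lam show False by simp
  qed
  have inv_eq: "of_nat b * w = 1 + (of_nat b - 1) * w ^ Suc m"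
    if "x ^ m = (of_nat b - 1) * (\<Sum>i<m. x ^ i)" "x \<noteq> 0" "w = 1 / x" for x w :: complex
  proof -
    have "x ^ m * (x - 1) = (of_nat b - 1) * (x ^ m - 1)"
      using power_diff_1_eq[of x m] that(1) by (simp add: mult_ac)
    then have "of_nat b * x ^ m = x ^ Suc m + (of_nat b - 1)"
      by (simp add: algebra_simps)
    then have "of_nat b * x ^ m / x ^ Suc m = 1 + (of_nat b - 1) / x ^ Suc m"
      using that(2) by (simp add: add_divide_distrib)
    then show ?thesis
      using that(2,3) by (simp add: power_divide)
  qed
  define w where "w = 1 / z"
  define u where "u = 1 / lam"
  have u: "0 < u" "u < 1"
    using lam(1) by (auto simp: u_def)
  have w: "cmod w \<le> 1"
    using z(2) by (auto simp: w_def norm_divide divide_le_eq)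
  have lamc: "complex_of_real lam ^ m = (of_nat b - 1) * (\<Sum>i<m. complex_of_real lam ^ i)"
    using arg_cong[OF lam(2), of complex_of_real] by simp
  have ew: "of_nat b * w = 1 + (of_nat b - 1) * w ^ Suc m"
    using inv_eq[OF z(1)] z(2) unfolding w_def by force
  have eu: "of_nat b * complex_of_real u = 1 + (of_nat b - 1) * complex_of_real u ^ Suc m"
    using inv_eq[OF lamc] lam(1) unfolding u_def by simp
  have wu: "w \<noteq> of_real u"
    using \<open>z \<noteq> of_real lam\<close> z(2) lam(1) unfolding w_def u_def by (auto simp: field_simps)
  have "of_nat b * (w - of_real u) = of_nat b * w - of_nat b * of_real u"
    by (rule right_diff_distrib)
  also have "\<dots> = (of_nat b - 1) * (w ^ Suc m - of_real u ^ Suc m)"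
    unfolding ew eu by (simp only: right_diff_distrib add_diff_cancel_left)
  also have "\<dots> = (w - of_real u) * ((of_nat b - 1) * (\<Sum>i<Suc m. w ^ i * of_real u ^ (m - i)))"
    by (subst power_diff_sumr2) (simp add: mult_ac)
  finally have Sw: "of_nat b = (of_nat b - 1) * (\<Sum>i<Suc m. w ^ i * of_real u ^ (m - i))"
    using wu by simp
  have "complex_of_real (real b * u) = of_real (1 + (real b - 1) * u ^ Suc m)"
    using eu by simp
  then have "real b * u = 1 + (real b - 1) * u ^ Suc m"
    by (simp only: of_real_eq_iff)
  then have "real b * (1 - u) = (real b - 1) * (1 - u ^ Suc m)"
    by (simp add: right_diff_distrib del: power_Suc)
  also have "\<dots> = (1 - u) * ((real b - 1) * (\<Sum>i<Suc m. u ^ i))"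
    by (simp only: one_diff_power_eq mult.left_commute)
  finally have Su: "real b = (real b - 1) * (\<Sum>i<Suc m. u ^ i)"
    using u by simp
  have Su': "(\<Sum>i<Suc m. u ^ i) = (\<Sum>i<Suc m. u ^ (m - i))"
    using sum.nat_diff_reindex[of "\<lambda>i. u ^ i" "Suc m"] by simp
  have "of_nat b = (of_nat b - 1) * complex_of_real (\<Sum>i<Suc m. u ^ (m - i))"
    using arg_cong[OF Su[unfolded Su'], of complex_of_real] by (simp del: sum.lessThan_Suc)
  moreover have "of_nat b - 1 \<noteq> (0 :: complex)" using b by auto
  ultimately have "(\<Sum>i<Suc m. w ^ i * of_real u ^ (m - i)) = of_real (\<Sum>i<Suc m. u ^ (m - i))"
    using Sw by (metis mult_left_cancel)
  then have "(\<Sum>i<Suc m. w ^ i * of_real (u ^ (m - i))) = of_real (\<Sum>i<Suc m. u ^ (m - i))"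
    by (simp only: of_real_power)
  then have "(\<Sum>i<Suc m. Re (w ^ i * of_real (u ^ (m - i)))) = (\<Sum>i<Suc m. u ^ (m - i))"
    unfolding Re_sum[symmetric] by (simp only: Re_complex_of_real)
  \<comment> \<open>Every summand is nonnegative because \<open>cmod w \<le> 1\<close> and
    \<open>u\<close> is positive, so each one vanishes; \<open>i = 1\<close> gives
    \<open>Re w = 1\<close>.\<close>
  then have Re_eq: "(\<Sum>i<Suc m. (1 - Re (w ^ i)) * u ^ (m - i)) = 0"
    by (simp add: left_diff_distrib sum_subtractf del: sum.lessThan_Suc)
  have "0 \<le> (1 - Re (w ^ i)) * u ^ (m - i)" for i
  proof -
    have "Re (w ^ i) \<le> cmod w ^ i"
      using complex_Re_le_cmod[of "w ^ i"] by (simp add: norm_power)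
    also have "\<dots> \<le> 1" using w by (simp add: power_le_one)
    finally show ?thesis using u by simp
  qed
  then have "\<forall>i\<in>{..<Suc m}. (1 - Re (w ^ i)) * u ^ (m - i) = 0"
    using Re_eq by (subst (asm) sum_nonneg_eq_0_iff) simp_all
  from this[THEN bspec, of 1] have "(1 - Re (w ^ 1)) * u ^ (m - 1) = 0"
    using m by simp
  then have "Re w = 1" using u by simp
  moreover from this have "1 + (Im w)\<^sup>2 \<le> 1"
    using w cmod_power2[of w] power_le_one[of "cmod w" 2] by simp
  ultimately have "w = 1"
    by (simp add: complex_eq_iff)
  then show False using z1 by (simp add: w_def)
qed

text \<open>Large roots are fixed points of \<open>z \<mapsto> b - 1 / z ^ n\<close>, a contraction of \<open>2 \<le> cmod z\<close>.\<close>

lemma distinct_root_unique: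
  fixes b n :: nat and x z :: complex
  assumes b: "3 \<le> b"
    and x: "x ^ Suc n - of_nat b * x ^ n + 1 = 0" "1 \<le> cmod x"
    and z: "z ^ Suc n - of_nat b * z ^ n + 1 = 0" "1 \<le> cmod z"
  shows "z = x"
proof (rule ccontr)
  assume "z \<noteq> x"
  \<comment> \<open>The root is within distance 1 of \<open>b\<close>, and \<open>b \<ge> 3\<close>
    then gives modulus at least 2.\<close>
  have fixed: "y = of_nat b - (1 / y) ^ n \<and> 2 \<le> cmod y"
    if y: "y ^ Suc n - of_nat b * y ^ n + 1 = 0" "1 \<le> cmod y" for y :: complex
  proof -
    have "y \<noteq> 0" using y(2) by auto
    have "(of_nat b - y) * y ^ n = 1"
      using y(1) by (simp add: algebra_simps)
    then have e: "of_nat b - y = (1 / y) ^ n"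
      unfolding power_one_over using \<open>y \<noteq> 0\<close> by (simp add: nonzero_eq_divide_eq)
    have "cmod ((1 / y) ^ n) \<le> 1"
      using y(2) unfolding norm_power norm_divide by (intro power_le_one) (auto simp: divide_le_eq)
    then have "real b - cmod y \<le> 1"
      using norm_triangle_ineq2[of "of_nat b" y] unfolding e[symmetric] by simp
    then show ?thesis using e b by (auto simp: algebra_simps)
  qed
  define u where "u = 1 / x"
  define w where "w = 1 / z"
  have nz: "x \<noteq> 0" "z \<noteq> 0" using x(2) z(2) by auto
  have "cmod (1 / y) \<le> 1 / 2" if "2 \<le> cmod y" for y :: complex
    using le_imp_inverse_le[OF that] by (simp add: norm_divide inverse_eq_divide)
  then have u: "cmod u \<le> 1 / 2" and w: "cmod w \<le> 1 / 2"
    using fixed[OF x] fixed[OF z] unfolding u_def w_def by blast+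
  have "n \<noteq> 0"
  proof
    assume "n = 0"
    have "x = of_nat b - 1" "z = of_nat b - 1"
      using conjunct1[OF fixed[OF x]] conjunct1[OF fixed[OF z]] unfolding \<open>n = 0\<close> power_0 .
    with \<open>z \<noteq> x\<close> show False by simp
  qed
  then obtain k where k: "n = Suc k" by (cases n) auto
  have "z - x = u ^ n - w ^ n"
  proof -
    have "z = of_nat b - w ^ n" "x = of_nat b - u ^ n"
      using fixed[OF x] fixed[OF z] unfolding u_def w_def by blast+
    then have "z - x = (of_nat b - w ^ n) - (of_nat b - u ^ n)" by (rule arg_cong2)
    then show ?thesis by simp
  qed
  also have "\<dots> = (u - w) * (\<Sum>i<n. u ^ i * w ^ (k - i))"
    unfolding power_diff_sumr2[of u n w]
    by (rule arg_cong[where f = "(*) (u - w)"], rule sum.cong) (simp_all add: k mult.commute)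
  also have "u - w = (z - x) * (u * w)"
    using nz by (simp add: u_def w_def field_simps)
  finally have "(z - x) * 1 = (z - x) * (u * w * (\<Sum>i<n. u ^ i * w ^ (k - i)))"
    by (simp add: mult_ac)
  then have "1 = u * w * (\<Sum>i<n. u ^ i * w ^ (k - i))"
    using \<open>z \<noteq> x\<close> by simp
  then have "1 = cmod u * cmod w * cmod (\<Sum>i<n. u ^ i * w ^ (k - i))"
    by (metis norm_mult norm_one)
  \<comment> \<open>The product is the contraction factor between the two fixed points; the bound
    \<open>n / 2 ^ Suc n < 1\<close> contradicts its being 1.\<close>
  also have "\<dots> \<le> (1 / 2) * (1 / 2) * (\<Sum>i<n. (1 / 2) ^ k)"
  proof (intro mult_mono u w)
    have "cmod (u ^ i * w ^ (k - i)) \<le> (1 / 2) ^ k" if "i < n" for i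
    proof -
      have "cmod (u ^ i * w ^ (k - i)) \<le> (1 / 2) ^ i * (1 / 2) ^ (k - i)"
        unfolding norm_mult norm_power by (intro mult_mono power_mono u w) auto
      also have "\<dots> = (1 / 2) ^ k"
        using that k by (simp flip: power_add)
      finally show ?thesis .
    qed
    then show "cmod (\<Sum>i<n. u ^ i * w ^ (k - i)) \<le> (\<Sum>i<n. (1 / 2) ^ k)"
      by (intro order_trans[OF norm_sum] sum_mono) auto
  qed auto
  also have "\<dots> = real n / 2 ^ Suc n"
    by (simp add: k power_divide)
  also have "\<dots> < 1"
  proof -
    have "real n < 2 ^ n" by (rule of_nat_less_two_power)
    moreover have "(0 :: real) < 2 ^ n" by simp
    ultimately have "real n < 2 ^ Suc n" unfolding power_Suc by linarith
    then show ?thesis by simp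
  qed
  finally show False by simp
qed

section \<open>Existence and uniqueness of the two Pisot numbers\<close>

lemma overlap_root:
  fixes b m :: nat
  assumes b: "3 \<le> b" and m: "2 \<le> m"
  shows "\<exists>!lam::real. pisot lam \<and> lam \<in> {real b - 1<..<real b} \<and>
    lam ^ m - (real b - 1) * (\<Sum>i<m. lam ^ i) = 0"
proof -
  let ?f = "\<lambda>x :: real. x ^ m - (real b - 1) * (\<Sum>i<m. x ^ i)"
  \<comment> \<open>Multiplying by \<open>x - 1\<close>, positive at both ends of the interval,
    exposes the signs of \<open>?f\<close> there.\<close>
  have f: "?f x * (x - 1) = x ^ m * (x - real b) + (real b - 1)" for x
  proof -
    have "?f x * (x - 1) = x ^ m * (x - 1) - (real b - 1) * ((x - 1) * (\<Sum>i<m. x ^ i))"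
      by (simp add: algebra_simps)
    also have "\<dots> = x ^ m * (x - real b) + (real b - 1)"
      unfolding power_diff_1_eq[symmetric] by (simp add: algebra_simps)
    finally show ?thesis .
  qed
  have "(real b - 1) ^ 1 < (real b - 1) ^ m"
    using b m by (intro power_strict_increasing) auto
  then have "?f (real b - 1) * (real b - 1 - 1) < 0"
    unfolding f by simp
  then have lo: "?f (real b - 1) < 0"
    using b by (simp add: mult_less_0_iff)
  have "?f (real b) * (real b - 1) > 0"
    unfolding f using b by simp
  then have hi: "0 < ?f (real b)"
    using b by (simp add: zero_less_mult_iff)
  have "\<exists>x. real b - 1 \<le> x \<and> x \<le> real b \<and> ?f x = 0"
    using lo hi by (intro IVT') (auto intro!: continuous_intros)
  then obtain x where x: "real b - 1 \<le> x" "x \<le> real b" "?f x = 0" by blast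
  then have x': "real b - 1 < x" "x < real b" "1 < x"
    using lo hi b by (auto simp: less_le)
  let ?q = "\<Sum>i<m. monom (1 - int b) i"
  let ?p = "monom 1 m + ?q"
  have p: "poly (map_poly of_int ?p) y = y ^ m - (of_nat b - 1) * (\<Sum>i<m. y ^ i)"
    for y :: "'a :: comm_ring_1"
    by (simp add: map_poly_of_int_add map_poly_of_int_sum poly_map_of_int_monom poly_sum
        sum_distrib_left left_diff_distrib sum_subtractf)
  have uniq: "z = of_real y" if "?f y = 0" "1 < y" "poly (map_poly of_int ?p) z = 0" "1 \<le> cmod z"
    for y :: real and z :: complex
    using that b m unfolding p by (intro overlap_root_unique[of b m]) auto
  have "degree ?q < m"
    using m by (intro degree_sum_less) (auto simp: degree_monom_eq intro: le_less_trans[OF degree_monom_le])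
  then have "lead_coeff ?p = 1" by (rule lead_coeff_monic)
  moreover have "poly (map_poly of_int ?p) x = 0"
    unfolding p using x(3) by simp
  ultimately have pis: "pisot x"
    using uniq[OF x(3) x'(3)] x'(3) by (intro pisot_if_dominant_root[of ?p])
  \<comment> \<open>Any real solution above \<open>b - 1\<close> is a complex root outside the open
    unit disc, so dominance also gives uniqueness.\<close>
  have eq: "y = x" if "real b - 1 < y" "?f y = 0" for y
  proof -
    have "poly (map_poly of_int ?p) (complex_of_real y) = of_real (?f y)"
      unfolding p by simp
    then have "complex_of_real y = of_real x"
      using that b by (intro uniq[OF x(3) x'(3)]) auto
    then show ?thesis by simp
  qed
  show ?thesis
    unfolding greaterThanLessThan_iff
    by (intro ex1I[of _ x] conjI pis x'(1,2) x(3) eq; elim conjE)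
qed

lemma distinct_root:
  fixes b m :: nat
  assumes b: "3 \<le> b" and m: "2 \<le> m"
  shows "\<exists>!\<eta>::real. pisot \<eta> \<and> \<eta> \<in> {real b - 1<..<real b} \<and>
    \<eta> ^ m - real b * \<eta> ^ (m - 1) + 1 = 0"
proof -
  obtain n where n: "m = Suc n" "1 \<le> n" using m by (cases m) auto
  let ?f = "\<lambda>x :: real. x ^ Suc n - real b * x ^ n + 1"
  \<comment> \<open>At \<open>b - 1\<close> the polynomial takes the value
    \<open>1 - (b - 1) ^ n\<close>, at \<open>b\<close> the value 1.\<close>
  have "1 < (real b - 1) ^ n"
    using b n by (intro one_less_power) auto
  then have lo: "?f (real b - 1) < 0"
    by (simp add: algebra_simps)
  have hi: "0 < ?f (real b)" by simp
  have "\<exists>x. real b - 1 \<le> x \<and> x \<le> real b \<and> ?f x = 0"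
    using lo hi by (intro IVT') (auto intro!: continuous_intros)
  then obtain x where x: "real b - 1 \<le> x" "x \<le> real b" "?f x = 0" by blast
  then have x': "real b - 1 < x" "x < real b" "1 < x"
    using lo hi b by (auto simp: less_le)
  let ?q = "monom (- int b) n + monom 1 0"
  let ?p = "monom 1 (Suc n) + ?q"
  have p: "poly (map_poly of_int ?p) y = y ^ Suc n - of_nat b * y ^ n + 1"
    for y :: "'a :: comm_ring_1"
    by (simp add: map_poly_of_int_add poly_map_of_int_monom)
  have px: "poly (map_poly of_int ?p) (complex_of_real y) = of_real (?f y)" for y
    unfolding p by simp
  have px0: "poly (map_poly of_int ?p) (complex_of_real x) = 0"
    unfolding px x(3) by simp
  have "1 \<le> cmod (of_real x)" using x' by simp
  with distinct_root_unique[OF b px0[unfolded p] this]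
  have uniq: "z = of_real x" if "poly (map_poly of_int ?p) z = 0" "1 \<le> cmod z" for z :: complex
    using that unfolding p by simp
  have "degree ?q < Suc n"
    by (intro degree_add_less) (auto intro: le_less_trans[OF degree_monom_le])
  then have "lead_coeff ?p = 1" by (rule lead_coeff_monic)
  moreover have "poly (map_poly of_int ?p) x = 0"
    unfolding p using x(3) by simp
  ultimately have pis: "pisot x"
    using uniq x'(3) by (intro pisot_if_dominant_root[of ?p])
  have eq: "y = x" if "real b - 1 < y" "?f y = 0" for y
  proof -
    have "complex_of_real y = of_real x"
      using that b px[of y] by (intro uniq) auto
    then show ?thesis by simp
  qed
  show ?thesis
    unfolding greaterThanLessThan_iff n(1) diff_Suc_1
    by (intro ex1I[of _ x] conjI pis x'(1,2) x(3) eq; elim conjE)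
qed

theorem theorem1p4:
  fixes b m :: nat
  assumes "b \<ge> 3" and "m \<ge> 2"
  shows
    "(\<exists>!lam::real. pisot lam \<and> lam \<in> {real b - 1<..<real b} \<and>
        lam ^ m - (real b - 1) * (\<Sum>i<m. lam ^ i) = 0) \<and>
     (\<forall>\<omega> lam. (\<forall>k. \<omega> k \<in> words b m) \<and> progressively_overlapping m \<omega> \<and>
        pisot lam \<and> lam \<in> {real b - 1<..<real b} \<and>
        lam ^ m - (real b - 1) * (\<Sum>i<m. lam ^ i) = 0 \<longrightarrow>
        ahlfors_regular (ln lam / ln (real b)) (K_set b m \<omega>)) \<and>
     (\<exists>!\<eta>::real. pisot \<eta> \<and> \<eta> \<in> {real b - 1<..<real b} \<and>
        \<eta> ^ m - real b * \<eta> ^ (m - 1) + 1 = 0) \<and>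
     (\<forall>\<omega> \<eta>. (\<forall>k. \<omega> k \<in> words b m) \<and> totally_distinct m \<omega> \<and>
        pisot \<eta> \<and> \<eta> \<in> {real b - 1<..<real b} \<and>
        \<eta> ^ m - real b * \<eta> ^ (m - 1) + 1 = 0 \<longrightarrow>
        ahlfors_regular (ln \<eta> / ln (real b)) (K_set b m \<omega>))"
proof (intro conjI allI impI)
  show "\<exists>!lam::real. pisot lam \<and> lam \<in> {real b - 1<..<real b} \<and>
      lam ^ m - (real b - 1) * (\<Sum>i<m. lam ^ i) = 0"
    by (rule overlap_root[OF assms])
  show "\<exists>!\<eta>::real. pisot \<eta> \<and> \<eta> \<in> {real b - 1<..<real b} \<and>
      \<eta> ^ m - real b * \<eta> ^ (m - 1) + 1 = 0"
    by (rule distinct_root[OF assms])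
qed (unfold greaterThanLessThan_iff,
  blast intro: ahlfors_regular_progressively_overlapping[OF assms],
  blast intro: ahlfors_regular_totally_distinct[OF assms])

end
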